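(* Assume that the Compatibility Assumption (stated in the context) holds, that the loss $\ell$ is $\Sigma^2$-subgaussian (in the sense defined in the context), and that $(\pi,P)$ satisfies a modified $\gamma$-LSI. Let $\zeta\in(0,1)$. Then, with probability at least $1-\zeta$ over $S\sim\mu_z^{\otimes n}$, for all $T>0$, $$\mathbb E\left[G_S(Y_T^S)\mid S\right]\le\frac{2\Sigma}{\sqrt n}\left\{\int_0^Te^{-\gamma(T-t)}\Delta_{P,P_S}(v_t)\,dt+e^{-\gamma T}\mathrm{KL}(\mu_0\|\pi)+\log\left(\frac3\zeta\right)\right\}^{1/2}.$$
   Context: $\mathcal P(\mathbb R^d)$ is the set of Borel probability measures on $\mathbb R^d$. For a Markov kernel $K$ on $\mathbb R^d$: $Kf(x)=\int f(y)\,K(x,dy)$ and $\mu K(A)=\int K(x,A)\,d\mu(x)$. $(\mathcal Z,\mathcal F)$ is a measurable space with a probability measure $\mu_z$, $n\ge1$, $\ell:\mathbb R^d\times\mathcal Z\to\mathbb R_+$ is a loss. For $S=(z_1,\dots,z_n)\in\mathcal Z^n$: $\mathcal R(w)=\int\ell(w,z)\,d\mu_z(z)$, $\widehat{\mathcal R}_S(w)=\frac1n\sum_i\ell(w,z_i)$, $G_S=\mathcal R-\widehat{\mathcal R}_S$. The loss is called $\Sigma^2$-subgaussian if for all $\lambda>0$ and all $w\in\mathbb R^d$, $\mathbb E_{Z\sim\mu_z}[e^{\lambda(\ell(w,Z)-\mathcal R(w))}]\le e^{\lambda^2\Sigma^2/2}$. For each $S\in\mathcal Z^n$, $(X^S_k)_{k\in\mathbb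 N}$ is a time-homogeneous Markov chain on $\mathbb R^d$ with Markov kernel $P_S$ and initial law $\mu_0\in\mathcal P(\mathbb R^d)$. $(N_t)_{t\ge0}$ is a Poisson process of intensity $1$ independent of all other random variables; $Y^S_t:=X^S_{N_t}$ and $\rho_t^S$ is the law of $Y_t^S$ given $S$. Prior: $P$ is a Markov kernel on $\mathbb R^d$ not depending on $S$, and $\pi\in\mathcal P(\mathbb R^d)$ satisfies $\pi P=\pi$. It is assumed that $\mu_0\ll\pi$. Write $v_t:=\frac{d\rho_t^S}{d\pi}$, and $\Delta_{P,P_S}(f):=\int f\,(P_S-P)(\log f)\,d\pi$ whenever defined. Dual operator: if $K$ is a Markov kernel such that $\mu\ll\pi\Rightarrow\mu K\ll\pi$, then $K^\star:L^1(\pi)\to L^1(\pi)$ is defined on non-negative $f$ with $\int f\,d\pi=1$ by $K^\star f=\frac{d(\mu K)}{d\pi}$ with $d\mu=f\,d\pi$, and extended linearly. Compatibility Assumption: $\mathrm{KL}(\mu_0\|\pi)<+\infty$; $v_0=d\mu_0/d\pi$ is bounded away from $0$; for all $t\ge0$ the map $S\mapsto\mathrm{KL}(\rho_t^S\|\pi)$ is $\mathcal F^{\otimes n}$-measurable; and for all $S\in\mathcal Z^n$: (H.1) for all $\mu\in\mathcal P(\mathbb R^d)$, $\mu\ll\pi$ implies $\mu P_S\ll\pi$; (H.2) for all $t\ge0$, $\Phi(P_S^\star v_t)\in L^1(\pi)$, where $\Phi(x)=x\log x$, $\Phi(0)=0$. Modified LSI: let $\mathcal E_{\pi,P}(f,g)=-\int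 g\,(P-I)f\,d\pi$; in particular $\mathcal E_{\pi,P}(\log f,f)=\iint f(x)[\log f(x)-\log f(y)]\,\pi(dx)P(x,dy)\in\mathbb R\cup\{+\infty\}$. Let $\mathrm{Ent}_\pi(f)=\int\Phi(f)\,d\pi-\Phi(\int f\,d\pi)$. The pair $(\pi,P)$ satisfies a modified $\gamma$-LSI if $\mathcal E_{\pi,P}(\log f,f)\ge\gamma\,\mathrm{Ent}_\pi(f)$ for every positive $f$ with $f\log f\in L^1(\pi)$.
   Formalization: The subgaussian bound on the loss is required for all real λ, not only λ>0: with λ>0 alone the claim is false, since the gap is governed by the lower tail of the loss. The loss is also taken jointly measurable with finite risk R(w). *)

theory Defs
  imports "HOL-Probability.Probability"
begin

definition markov_kernel :: "('a::topological_space \<Rightarrow> 'a measure) \<Rightarrow> bool" where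
  "markov_kernel K \<longleftrightarrow> K \<in> borel \<rightarrow>\<^sub>M prob_algebra borel"

definition history :: "'w measure \<Rightarrow> (nat \<Rightarrow> 'w \<Rightarrow> 'a::topological_space) \<Rightarrow> nat \<Rightarrow> 'w measure" where
  "history M X k =
     vimage_algebra (space M) (\<lambda>\<omega>. \<lambda>i\<in>{..k}. X i \<omega>) (\<Pi>\<^sub>M i\<in>{..k}. borel)"

definition markov_chain ::
  "'w measure \<Rightarrow> (nat \<Rightarrow> 'w \<Rightarrow> 'a::topological_space) \<Rightarrow> 'a measure \<Rightarrow> ('a \<Rightarrow> 'a measure) \<Rightarrow> bool" where
  "markov_chain M X \<mu>\<^sub>0 K \<longleftrightarrow>
     (\<forall>k. X k \<in> borel_measurable M) \<and>
     distr M borel (X 0) = \<mu>\<^sub>0 \<and>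
     (\<forall>k. \<forall>A\<in>sets borel. AE \<omega> in M.
        real_cond_exp M (history M X k) (\<lambda>\<omega>. indicator A (X (Suc k) \<omega>)) \<omega> = measure (K (X k \<omega>)) A)"

text \<open>
  The truncated subtraction of natural numbers is harmless below, because the paths are almost
  surely nondecreasing.
\<close>

definition poisson_process :: "'w measure \<Rightarrow> real \<Rightarrow> (real \<Rightarrow> 'w \<Rightarrow> nat) \<Rightarrow> bool" where
  "poisson_process M r N \<longleftrightarrow>
     (\<forall>t\<ge>0. N t \<in> M \<rightarrow>\<^sub>M count_space UNIV) \<and>
     (AE \<omega> in M. N 0 \<omega> = 0 \<and> mono_on {0..} (\<lambda>t. N t \<omega>) \<and>
        (\<forall>t\<ge>0. continuous (at_right t) (\<lambda>t. N t \<omega>))) \<and>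
     (\<forall>\<tau>::nat \<Rightarrow> real. 0 \<le> \<tau> 0 \<longrightarrow> mono \<tau> \<longrightarrow>
        prob_space.indep_vars M (\<lambda>_. count_space UNIV)
          (\<lambda>i \<omega>. N (\<tau> (Suc i)) \<omega> - N (\<tau> i) \<omega>) UNIV) \<and>
     (\<forall>s t. 0 \<le> s \<longrightarrow> s < t \<longrightarrow>
        distr M (count_space UNIV) (\<lambda>\<omega>. N t \<omega> - N s \<omega>) = measure_pmf (poisson_pmf (r * (t - s))))"

definition indep_processes ::
  "'w measure \<Rightarrow> (nat \<Rightarrow> 'w \<Rightarrow> 'a::topological_space) \<Rightarrow> (real \<Rightarrow> 'w \<Rightarrow> nat) \<Rightarrow> bool" where
  "indep_processes M X N \<longleftrightarrow>
     prob_space.indep_set M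
       (sets (vimage_algebra (space M) (\<lambda>\<omega> k. X k \<omega>) (\<Pi>\<^sub>M k\<in>UNIV. borel)))
       (sets (vimage_algebra (space M) (\<lambda>\<omega>. \<lambda>t\<in>{0..}. N t \<omega>) (\<Pi>\<^sub>M t\<in>{0..}. count_space UNIV)))"

definition poissonized :: "(nat \<Rightarrow> 'w \<Rightarrow> 'a) \<Rightarrow> (real \<Rightarrow> 'w \<Rightarrow> nat) \<Rightarrow> real \<Rightarrow> 'w \<Rightarrow> 'a" where
  "poissonized X N t \<omega> = X (N t \<omega>) \<omega>"

definition risk :: "'z measure \<Rightarrow> ('a \<Rightarrow> 'z \<Rightarrow> real) \<Rightarrow> 'a \<Rightarrow> real" where
  "risk \<mu>\<^sub>z l w = (\<integral>z. l w z \<partial>\<mu>\<^sub>z)"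

definition empirical_risk :: "nat \<Rightarrow> ('a \<Rightarrow> 'z \<Rightarrow> real) \<Rightarrow> (nat \<Rightarrow> 'z) \<Rightarrow> 'a \<Rightarrow> real" where
  "empirical_risk n l S w = (\<Sum>i<n. l w (S i)) / real n"

definition gen_gap ::
  "'z measure \<Rightarrow> nat \<Rightarrow> ('a \<Rightarrow> 'z \<Rightarrow> real) \<Rightarrow> (nat \<Rightarrow> 'z) \<Rightarrow> 'a \<Rightarrow> real" where
  "gen_gap \<mu>\<^sub>z n l S w = risk \<mu>\<^sub>z l w - empirical_risk n l S w"

text \<open>
  The bound is required for all real \<open>s\<close>, not only for \<open>s > 0\<close>. The quantity to be bounded,
  \<^const>\<open>gen_gap\<close>, is governed by the lower tail of the loss, which \<open>s > 0\<close> leaves uncontrolled: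
  let \<open>n = 1\<close>, and for all \<open>w\<close> let \<open>l w\<close> be \<open>0\<close> with probability \<open>p = 1 / 100\<close> and \<open>1 / (1 - p)\<close>
  otherwise. The bound holds for \<open>s > 0\<close> with \<open>v = p / (1 - p)\<close>, but with probability \<open>p\<close> the gap
  is \<open>1\<close>, which exceeds \<open>2 * sqrt (v * ln (3 / \<zeta>))\<close> for \<open>\<zeta>\<close> slightly below \<open>p\<close>.

  The expectation is a nonnegative integral, so the bound includes its finiteness.
\<close>

definition subgaussian_loss :: "'z measure \<Rightarrow> ('a \<Rightarrow> 'z \<Rightarrow> real) \<Rightarrow> real \<Rightarrow> bool" where
  "subgaussian_loss \<mu>\<^sub>z l v \<longleftrightarrow>
     (\<forall>w. integrable \<mu>\<^sub>z (l w) \<and>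
        (\<forall>s::real. (\<integral>\<^sup>+z. ennreal (exp (s * (l w z - risk \<mu>\<^sub>z l w))) \<partial>\<mu>\<^sub>z)
                  \<le> ennreal (exp (s\<^sup>2 * v / 2))))"

definition \<Phi> :: "real \<Rightarrow> real" where
  "\<Phi> x = x * ln x"

definition Ent :: "'a measure \<Rightarrow> ('a \<Rightarrow> real) \<Rightarrow> real" where
  "Ent \<pi> f = (\<integral>x. \<Phi> (f x) \<partial>\<pi>) - \<Phi> (\<integral>x. f x \<partial>\<pi>)"

text \<open>
  \<open>kl \<mu> \<pi>\<close> is KL\<open>(\<mu> \<parallel> \<pi>)\<close>; the library's \<^const>\<open>KL_divergence\<close> has the arguments in the
  opposite order and is real-valued. For probability measures the negative part of the log-density
  is always \<open>\<mu>\<close>-integrable, so the divergence is infinite iff the log-density is not integrable.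
\<close>

definition kl :: "'a measure \<Rightarrow> 'a measure \<Rightarrow> ereal" where
  "kl \<mu> \<pi> =
     (if absolutely_continuous \<pi> \<mu> \<and> integrable \<mu> (entropy_density (exp 1) \<pi> \<mu>)
      then ereal (KL_divergence (exp 1) \<pi> \<mu>) else \<infinity>)"

definition dens :: "'a measure \<Rightarrow> 'a measure \<Rightarrow> 'a \<Rightarrow> real" where
  "dens \<pi> \<mu> x = enn2real (RN_deriv \<pi> \<mu> x)"

text \<open>
  The dual operator \<open>K\<^sup>\<star>\<close> on probability densities \<open>f\<close> with respect to \<open>\<pi>\<close>, which is the only
  place where it is needed here.
\<close>

definition dual_op ::
  "'a measure \<Rightarrow> ('a \<Rightarrow> 'a measure) \<Rightarrow> ('a \<Rightarrow> real) \<Rightarrow> 'a \<Rightarrow> real" where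
  "dual_op \<pi> K f = dens \<pi> (density \<pi> (\<lambda>x. ennreal (f x)) \<bind> K)"

text \<open>
  Both \<open>ln f\<close> under the kernels and the outer integrand have to be integrable for \<open>kernel_diff\<close> to
  carry its meaning. For \<open>f\<close> bounded away from \<open>0\<close> with \<open>\<Phi> f\<close>, \<open>\<Phi> (P\<^sup>\<star> f)\<close>, \<open>\<Phi> (Q\<^sup>\<star> f)\<close> integrable this
  follows from \<open>a * ln b \<le> \<Phi> a + b - a\<close>.
\<close>

definition kernel_diff ::
  "'a measure \<Rightarrow> ('a \<Rightarrow> 'a measure) \<Rightarrow> ('a \<Rightarrow> 'a measure) \<Rightarrow> ('a \<Rightarrow> real) \<Rightarrow> real" where
  "kernel_diff \<pi> P Q f =
     (\<integral>x. f x * ((\<integral>y. ln (f y) \<partial>Q x) - (\<integral>y. ln (f y) \<partial>P x)) \<partial>\<pi>)"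

text \<open>
  \<open>log_dirichlet \<pi> P f\<close> is the Dirichlet form at \<open>(log f, f)\<close>, with values in \<open>(-\<infinity>, \<infinity>]\<close>. It is
  the difference of the integrals of the positive and the negative part of the integrand
  (\<^const>\<open>ennreal\<close> truncates negative numbers). The integrand is at least \<open>f x - f y\<close>, so the
  second integral is finite when \<open>\<pi>\<close> is invariant under \<open>P\<close> and \<open>f\<close> is \<open>\<pi>\<close>-integrable.
\<close>

definition log_dirichlet :: "'a measure \<Rightarrow> ('a \<Rightarrow> 'a measure) \<Rightarrow> ('a \<Rightarrow> real) \<Rightarrow> ereal" where
  "log_dirichlet \<pi> P f =
     enn2ereal (\<integral>\<^sup>+x. (\<integral>\<^sup>+y. ennreal (f x * (ln (f x) - ln (f y))) \<partial>P x) \<partial>\<pi>)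
   - enn2ereal (\<integral>\<^sup>+x. (\<integral>\<^sup>+y. ennreal (- (f x * (ln (f x) - ln (f y)))) \<partial>P x) \<partial>\<pi>)"

definition modified_LSI ::
  "'a::topological_space measure \<Rightarrow> ('a \<Rightarrow> 'a measure) \<Rightarrow> real \<Rightarrow> bool" where
  "modified_LSI \<pi> P \<gamma> \<longleftrightarrow>
     (\<forall>f \<in> borel_measurable borel.
        (\<forall>x. 0 < f x) \<longrightarrow> integrable \<pi> (\<lambda>x. f x * ln (f x)) \<longrightarrow>
        ereal (\<gamma> * Ent \<pi> f) \<le> log_dirichlet \<pi> P f)"

end

theory Submission
  imports Defs
begin

text \<open>
  By the Poissonization, \<open>v\<^sub>t\<close> solves \<open>v' = P\<^sub>S\<^sup>\<star> v - v\<close>, so \<open>KL(\<rho>\<^sub>t \<parallel> \<pi>)\<close> has the derivative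
  \<open>\<integral> v\<^sub>t (P\<^sub>S - I) log v\<^sub>t d\<pi> = \<Delta>(v\<^sub>t) - \<E>(log v\<^sub>t, v\<^sub>t) \<le> \<Delta>(v\<^sub>t) - \<gamma> KL(\<rho>\<^sub>t \<parallel> \<pi>)\<close>, and Gronwall's lemma
  bounds \<open>KL(\<rho>\<^sub>T \<parallel> \<pi>)\<close>. Instead of differentiating under the integral, the pointwise identity for
  \<open>exp (\<gamma> t) \<Phi>(v\<^sub>t)\<close> is integrated in time and then over \<open>\<pi>\<close>.

  For the generalization bound, \<open>G\<^sub>S(w)\<close> is \<open>\<Sigma>\<^sup>2/n\<close>-subgaussian, hence \<open>E exp (n G\<^sup>2 / (4 \<Sigma>\<^sup>2)) \<le> \<surd>2\<close>.
  By Markov's inequality \<open>\<integral> exp (n G\<^sup>2 / (4 \<Sigma>\<^sup>2)) d\<pi> \<le> 3/\<zeta>\<close> with probability at least \<open>1 - \<zeta>\<close>, and then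
  Donsker and Varadhan's inequality gives \<open>n/(4 \<Sigma>\<^sup>2) (E\<^sub>\<rho> G)\<^sup>2 \<le> KL(\<rho> \<parallel> \<pi>) + log (3/\<zeta>)\<close> for all \<open>\<rho>\<close> at once,
  in particular for \<open>\<rho>\<^sub>T\<close> with any \<open>T\<close>.
\<close>

section \<open>Exponential moments of the generalization gap\<close>

text \<open>The evolution equation for \<open>v_t\<close> has to hold at every point in order to be
  integrated in time there, whereas Radon-Nikodym derivatives are fixed only up to a null set for
  each t. Hence densities of the laws of the jump chain are chosen once, in versions whose Poisson
  series converge everywhere, and what is assumed about \<open>dens\<close> is carried over to them
  almost everywhere. Exchanging the two integrals then needs one integrable bound on the whole of
  [0, T]: the lower bound of \<open>v_0\<close> survives up to a factor exp (-T) and controls the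
  logarithm from below, and (H.2) at time T controls it from above. The same bounds make the
  Dirichlet form finite, so that the term that it shares with \<Delta> may be cancelled.

  For the constants, put \<sigma> = \<Sigma> / sqrt n. The moment of exp (a G^2) can be infinite
  from a = 1 / (2 \<sigma>^2) on; half of that gives the bound sqrt 2, the factor 2 \<Sigma> / sqrt
  n is 1 / sqrt a, and 3 is a round number above sqrt 2. When \<Sigma> = 0 there is no such a, and
  the gap vanishes almost surely instead.\<close>

lemma nn_integral_normal_density:
  assumes "0 < \<sigma>"
  shows "(\<integral>\<^sup>+x. ennreal (normal_density \<mu> \<sigma> x) \<partial>lborel) = 1"
  using assms by (subst nn_integral_eq_integral) auto

text \<open>The square is linearised by a Gaussian variable, whose moment generating function
  is \<open>c \<mapsto> exp (c\<^sup>2 / 2)\<close>; then the two integrals are exchanged.\<close>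

lemma subgaussian_exp_square:
  assumes "prob_space M" and [measurable]: "G \<in> borel_measurable M" and "0 < \<sigma>"
    and mgf: "\<And>s::real. (\<integral>\<^sup>+\<omega>. ennreal (exp (s * G \<omega>)) \<partial>M) \<le> ennreal (exp (s\<^sup>2 * \<sigma>\<^sup>2 / 2))"
  shows "(\<integral>\<^sup>+\<omega>. ennreal (exp ((G \<omega>)\<^sup>2 / (4 * \<sigma>\<^sup>2))) \<partial>M) \<le> ennreal (sqrt 2)"
proof -
  interpret prob_space M by fact
  interpret pair_sigma_finite lborel M ..
  have gauss: "ennreal (exp (c\<^sup>2 / 2)) = (\<integral>\<^sup>+g. ennreal (normal_density 0 1 g * exp (c * g)) \<partial>lborel)"
    for c :: real
  proof -
    \<comment> \<open>Completing the square:
      \<open>c * g - g\<^sup>2 / 2 = c\<^sup>2 / 2 - (g - c)\<^sup>2 / 2\<close>.\<close>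
    have "normal_density 0 1 g * exp (c * g) = exp (c\<^sup>2 / 2) * normal_density c 1 g" for g
      unfolding normal_density_def
      by (simp add: mult_exp_exp) (simp add: power2_eq_square algebra_simps diff_divide_distrib add_divide_distrib)
    then have "(\<integral>\<^sup>+g. ennreal (normal_density 0 1 g * exp (c * g)) \<partial>lborel)
        = (\<integral>\<^sup>+g. ennreal (exp (c\<^sup>2 / 2)) * ennreal (normal_density c 1 g) \<partial>lborel)"
      by (simp add: ennreal_mult)
    then show ?thesis
      by (simp add: nn_integral_cmult nn_integral_normal_density)
  qed
  have "(\<integral>\<^sup>+\<omega>. ennreal (exp ((G \<omega>)\<^sup>2 / (4 * \<sigma>\<^sup>2))) \<partial>M)
      = (\<integral>\<^sup>+\<omega>. ennreal (exp ((G \<omega> / (sqrt 2 * \<sigma>))\<^sup>2 / 2)) \<partial>M)"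
    by (simp add: power_divide power_mult_distrib)
  also have "\<dots> = (\<integral>\<^sup>+\<omega>. \<integral>\<^sup>+g. ennreal (normal_density 0 1 g * exp (G \<omega> / (sqrt 2 * \<sigma>) * g)) \<partial>lborel \<partial>M)"
    by (simp only: gauss)
  also have "\<dots> = (\<integral>\<^sup>+g. \<integral>\<^sup>+\<omega>. ennreal (normal_density 0 1 g * exp (G \<omega> / (sqrt 2 * \<sigma>) * g)) \<partial>M \<partial>lborel)"
    by (rule Fubini') simp
  \<comment> \<open>The bound on the moment generating function contributes exp (g^2 / 4), which
    cancels half of the Gaussian exponent. What remains has the shape of a normal density of
    variance 2, off by the ratio \<open>sqrt 2\<close> of the normalising constants.\<close>
  also have "\<dots> \<le> (\<integral>\<^sup>+g. ennreal (sqrt 2 * normal_density 0 (sqrt 2) g) \<partial>lborel)"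
  proof (rule nn_integral_mono)
    fix g :: real
    have "(\<integral>\<^sup>+\<omega>. ennreal (normal_density 0 1 g * exp (G \<omega> / (sqrt 2 * \<sigma>) * g)) \<partial>M)
        = ennreal (normal_density 0 1 g) * (\<integral>\<^sup>+\<omega>. ennreal (exp (g / (sqrt 2 * \<sigma>) * G \<omega>)) \<partial>M)"
      by (subst nn_integral_cmult[symmetric]) (auto simp: ennreal_mult mult_ac)
    also have "\<dots> \<le> ennreal (normal_density 0 1 g) * ennreal (exp ((g / (sqrt 2 * \<sigma>))\<^sup>2 * \<sigma>\<^sup>2 / 2))"
      by (intro mult_left_mono mgf) simp
    also have "\<dots> = ennreal (normal_density 0 1 g * exp (g\<^sup>2 / 4))"
      using \<open>0 < \<sigma>\<close> by (simp add: ennreal_mult power_divide power_mult_distrib)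
    also have "normal_density 0 1 g * exp (g\<^sup>2 / 4) = sqrt 2 * normal_density 0 (sqrt 2) g"
      unfolding normal_density_def
      by (simp add: mult_exp_exp real_sqrt_mult field_simps)
    finally show "(\<integral>\<^sup>+\<omega>. ennreal (normal_density 0 1 g * exp (G \<omega> / (sqrt 2 * \<sigma>) * g)) \<partial>M)
      \<le> ennreal (sqrt 2 * normal_density 0 (sqrt 2) g)" .
  qed
  also have "\<dots> = (\<integral>\<^sup>+g. ennreal (sqrt 2) * ennreal (normal_density 0 (sqrt 2) g) \<partial>lborel)"
    by (simp add: ennreal_mult)
  also have "\<dots> = ennreal (sqrt 2)"
    by (simp add: nn_integral_cmult nn_integral_normal_density)
  finally show ?thesis .
qed

lemma measurable_risk [measurable]:
  assumes "prob_space \<mu>\<^sub>z" and [measurable]: "(\<lambda>(w, z). l w z) \<in> borel_measurable (borel \<Otimes>\<^sub>M \<mu>\<^sub>z)"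
  shows "risk \<mu>\<^sub>z l \<in> borel_measurable borel"
proof -
  interpret prob_space \<mu>\<^sub>z by fact
  show ?thesis
    unfolding risk_def by measurable
qed

lemma measurable_gen_gap:
  assumes z: "prob_space \<mu>\<^sub>z" and l[measurable]: "(\<lambda>(w, z). l w z) \<in> borel_measurable (borel \<Otimes>\<^sub>M \<mu>\<^sub>z)"
  shows "(\<lambda>(w, S). gen_gap \<mu>\<^sub>z n l S w) \<in> borel_measurable (borel \<Otimes>\<^sub>M (\<Pi>\<^sub>M i\<in>{..<n}. \<mu>\<^sub>z))"
proof -
  note [measurable] = measurable_risk[OF z l]
  have [measurable]: "(\<lambda>x. l (fst x) (snd x i)) \<in> borel_measurable (borel \<Otimes>\<^sub>M (\<Pi>\<^sub>M i\<in>{..<n}. \<mu>\<^sub>z))"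
    if "i \<in> {..<n}" for i
    using that by measurable
  show ?thesis
    unfolding gen_gap_def empirical_risk_def by (simp add: split_beta') measurable
qed

text \<open>The gap is minus the average of the centred losses, so its exponential factorises over
  the product measure, with parameter \<open>- s / n\<close> in each factor: an upper bound on the
  gap uses the lower tail of the loss. The n factors with variance term
  \<open>(s / n)\<^sup>2 * v\<close> leave \<open>v / n\<close>.\<close>

lemma gen_gap_mgf:
  assumes z: "prob_space \<mu>\<^sub>z" and n: "1 \<le> n"
    and l[measurable]: "(\<lambda>(w, z). l w z) \<in> borel_measurable (borel \<Otimes>\<^sub>M \<mu>\<^sub>z)"
    and sub: "subgaussian_loss \<mu>\<^sub>z l v"
  shows "(\<integral>\<^sup>+S. ennreal (exp (s * gen_gap \<mu>\<^sub>z n l S w)) \<partial>(\<Pi>\<^sub>M i\<in>{..<n}. \<mu>\<^sub>z))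
      \<le> ennreal (exp (s\<^sup>2 * (v / real n) / 2))"
proof -
  interpret prob_space \<mu>\<^sub>z by fact
  interpret product_sigma_finite "\<lambda>i. \<mu>\<^sub>z" ..
  have [measurable]: "l w \<in> borel_measurable \<mu>\<^sub>z"
    by measurable
  have "s * gen_gap \<mu>\<^sub>z n l S w = (\<Sum>i<n. (- s / n) * (l w (S i) - risk \<mu>\<^sub>z l w))" for S
    unfolding sum_distrib_left[symmetric] sum_subtractf gen_gap_def empirical_risk_def
    using n by (simp add: field_simps)
  then have "(\<integral>\<^sup>+S. ennreal (exp (s * gen_gap \<mu>\<^sub>z n l S w)) \<partial>(\<Pi>\<^sub>M i\<in>{..<n}. \<mu>\<^sub>z))
      = (\<integral>\<^sup>+S. (\<Prod>i<n. ennreal (exp ((- s / n) * (l w (S i) - risk \<mu>\<^sub>z l w)))) \<partial>(\<Pi>\<^sub>M i\<in>{..<n}. \<mu>\<^sub>z))"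
    by (simp add: exp_sum prod_ennreal)
  also have "\<dots> = (\<Prod>i<n. \<integral>\<^sup>+z. ennreal (exp ((- s / n) * (l w z - risk \<mu>\<^sub>z l w))) \<partial>\<mu>\<^sub>z)"
    by (rule product_nn_integral_prod) auto
  also have "\<dots> \<le> (\<Prod>i<n. ennreal (exp ((- s / n)\<^sup>2 * v / 2)))"
    unfolding prod_constant using sub[unfolded subgaussian_loss_def, rule_format, of w]
    by (intro power_mono) (blast, simp)
  also have "\<dots> = ennreal (exp (s\<^sup>2 * (v / real n) / 2))"
    using n by (simp add: ennreal_power exp_of_nat_mult[symmetric] power2_eq_square field_simps)
  finally show ?thesis .
qed

text \<open>The substitute for \<open>subgaussian_exp_square\<close>, which needs a positive
  \<open>\<sigma>\<close>. The moment generating function at the two arguments 1 and -1 decides the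
  matter.\<close>

lemma subgaussian_loss_0:
  assumes z: "prob_space \<mu>\<^sub>z" and n: "1 \<le> n"
    and l[measurable]: "(\<lambda>(w, z). l w z) \<in> borel_measurable (borel \<Otimes>\<^sub>M \<mu>\<^sub>z)"
    and sub: "subgaussian_loss \<mu>\<^sub>z l 0"
  shows "AE S in (\<Pi>\<^sub>M i\<in>{..<n}. \<mu>\<^sub>z). gen_gap \<mu>\<^sub>z n l S w = 0"
proof -
  interpret prob_space "\<Pi>\<^sub>M i\<in>{..<n}. \<mu>\<^sub>z"
    using z by (intro prob_space_PiM)
  note [measurable] = measurable_gen_gap[OF z l]
  let ?G = "\<lambda>S. gen_gap \<mu>\<^sub>z n l S w"
  have G[measurable]: "?G \<in> borel_measurable (\<Pi>\<^sub>M i\<in>{..<n}. \<mu>\<^sub>z)"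
    by measurable
  \<comment> \<open>\<open>cosh G - 1 \<ge> 0\<close> has nonpositive mean.\<close>
  have "(\<integral>\<^sup>+S. ennreal (exp (?G S)) + ennreal (exp (- ?G S)) \<partial>(\<Pi>\<^sub>M i\<in>{..<n}. \<mu>\<^sub>z)) \<le> 1 + 1"
    using gen_gap_mgf[OF z n l sub, of 1 w] gen_gap_mgf[OF z n l sub, of "- 1" w]
    by (subst nn_integral_add) (auto intro!: add_mono simp: ennreal_1[symmetric] simp del: ennreal_1)
  \<comment> \<open>Splitting off 2 leaves a nonnegative remainder, so that the constant can be
    cancelled in \<open>ennreal\<close> without subtraction.\<close>
  moreover have "(\<integral>\<^sup>+S. ennreal (exp (?G S)) + ennreal (exp (- ?G S)) \<partial>(\<Pi>\<^sub>M i\<in>{..<n}. \<mu>\<^sub>z))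
      = (\<integral>\<^sup>+S. 2 + ennreal (exp (?G S) + exp (- ?G S) - 2) \<partial>(\<Pi>\<^sub>M i\<in>{..<n}. \<mu>\<^sub>z))"
  proof (rule nn_integral_cong)
    fix S
    have "0 \<le> (exp (?G S / 2) - exp (- ?G S / 2))\<^sup>2"
      by simp
    also have "\<dots> = exp (?G S) + exp (- ?G S) - 2"
      by (simp add: power2_diff mult_exp_exp flip: exp_double)
    finally show "ennreal (exp (?G S)) + ennreal (exp (- ?G S)) = 2 + ennreal (exp (?G S) + exp (- ?G S) - 2)"
      by (simp flip: ennreal_plus ennreal_numeral)
  qed
  ultimately have "2 + (\<integral>\<^sup>+S. ennreal (exp (?G S) + exp (- ?G S) - 2) \<partial>(\<Pi>\<^sub>M i\<in>{..<n}. \<mu>\<^sub>z)) \<le> 2 + 0"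
    by (simp add: nn_integral_add emeasure_space_1)
  then have "(\<integral>\<^sup>+S. ennreal (exp (?G S) + exp (- ?G S) - 2) \<partial>(\<Pi>\<^sub>M i\<in>{..<n}. \<mu>\<^sub>z)) = 0"
    by (subst (asm) ennreal_add_left_cancel_le) auto
  then have "AE S in (\<Pi>\<^sub>M i\<in>{..<n}. \<mu>\<^sub>z). ennreal (exp (?G S) + exp (- ?G S) - 2) = 0"
    by (subst (asm) nn_integral_0_iff_AE) auto
  then show ?thesis
  proof (rule AE_mp, intro AE_I2 impI)
    fix S assume "ennreal (exp (?G S) + exp (- ?G S) - 2) = 0"
    then have "exp (?G S) + exp (- ?G S) - 2 \<le> 0"
      by (simp add: ennreal_eq_0_iff)
    then have "(exp (?G S / 2) - exp (- ?G S / 2))\<^sup>2 \<le> 0"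
      by (simp add: power2_diff mult_exp_exp exp_minus_inverse mult.assoc flip: exp_double)
    then show "?G S = 0"
      by simp
  qed
qed

text \<open>A single event works for all posteriors at once: it is a bound on an exponential moment
  under the prior, which Donsker and Varadhan's inequality transfers to every \<open>\<rho> \<lless> \<pi>\<close>.\<close>

lemma exp_moment_event:
  assumes z: "prob_space \<mu>\<^sub>z" and n: "1 \<le> n"
    and l[measurable]: "(\<lambda>(w, z). l w z) \<in> borel_measurable (borel \<Otimes>\<^sub>M \<mu>\<^sub>z)"
    and \<pi>: "prob_space \<pi>" and [measurable_cong]: "sets \<pi> = sets borel"
    and "0 < \<Sigma>" and sub: "subgaussian_loss \<mu>\<^sub>z l (\<Sigma>\<^sup>2)" and "0 < \<zeta>"
  defines "\<D> \<equiv> \<Pi>\<^sub>M i\<in>{..<n}. \<mu>\<^sub>z"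
  shows "\<exists>A\<in>sets \<D>. 1 - \<zeta> \<le> measure \<D> A \<and>
    (\<forall>S\<in>A. (\<integral>\<^sup>+w. ennreal (exp (real n / (4 * \<Sigma>\<^sup>2) * (gen_gap \<mu>\<^sub>z n l S w)\<^sup>2)) \<partial>\<pi>) \<le> ennreal (3 / \<zeta>))"
proof -
  interpret D: prob_space \<D>
    unfolding \<D>_def using z by (intro prob_space_PiM)
  interpret \<pi>: prob_space \<pi> by fact
  interpret pair_sigma_finite \<pi> \<D> ..
  have [measurable]: "(\<lambda>(w, S). gen_gap \<mu>\<^sub>z n l S w) \<in> borel_measurable (borel \<Otimes>\<^sub>M \<D>)"
    unfolding \<D>_def by (rule measurable_gen_gap[OF z l])
  define E where "E S w = ennreal (exp (real n / (4 * \<Sigma>\<^sup>2) * (gen_gap \<mu>\<^sub>z n l S w)\<^sup>2))" for S w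
  have [measurable]: "(\<lambda>(w, S). E S w) \<in> borel_measurable (\<pi> \<Otimes>\<^sub>M \<D>)"
    unfolding E_def by measurable
  have [measurable]: "(\<lambda>(S, w). E S w) \<in> borel_measurable (\<D> \<Otimes>\<^sub>M \<pi>)"
    unfolding E_def by measurable
  let ?I = "\<lambda>S. \<integral>\<^sup>+w. E S w \<partial>\<pi>"
  have I[measurable]: "?I \<in> borel_measurable \<D>"
    by measurable
  define B where "B = {S \<in> space \<D>. ennreal (3 / \<zeta>) \<le> ?I S}"
  have B: "B \<in> sets \<D>"
    unfolding B_def by measurable
  have "(\<integral>\<^sup>+S. E S w \<partial>\<D>) \<le> ennreal 3" for w
  proof -
    have G: "(\<lambda>S. gen_gap \<mu>\<^sub>z n l S w) \<in> borel_measurable \<D>"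
      by measurable
    \<comment> \<open>By \<open>gen_gap_mgf\<close> the gap has the subgaussian parameter
      \<open>\<Sigma> / sqrt n\<close>, for which \<open>1 / (4 * \<sigma>\<^sup>2)\<close> is the
      coefficient in \<open>E\<close>.\<close>
    have "(\<integral>\<^sup>+S. ennreal (exp ((gen_gap \<mu>\<^sub>z n l S w)\<^sup>2 / (4 * (\<Sigma> / sqrt n)\<^sup>2))) \<partial>\<D>) \<le> ennreal (sqrt 2)"
      using n \<open>0 < \<Sigma>\<close> gen_gap_mgf[OF z n l sub, of _ w]
      by (intro subgaussian_exp_square D.prob_space_axioms G) (auto simp: power_divide \<D>_def)
    also have "\<dots> \<le> ennreal 3"
      using real_sqrt_le_mono[of 2 9] by (intro ennreal_leI) simp
    finally show ?thesis
      using n by (simp add: E_def power_divide field_simps)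
  qed
  then have "(\<integral>\<^sup>+w. \<integral>\<^sup>+S. E S w \<partial>\<D> \<partial>\<pi>) \<le> (\<integral>\<^sup>+w. ennreal 3 \<partial>\<pi>)"
    by (intro nn_integral_mono)
  also have "(\<integral>\<^sup>+w. \<integral>\<^sup>+S. E S w \<partial>\<D> \<partial>\<pi>) = (\<integral>\<^sup>+S. ?I S \<partial>\<D>)"
    by (rule Fubini'[symmetric]) simp
  finally have I3: "(\<integral>\<^sup>+S. ?I S \<partial>\<D>) \<le> ennreal 3"
    by (simp add: \<pi>.emeasure_space_1 del: ennreal_numeral)
  have "ennreal (3 / \<zeta>) * emeasure \<D> B = (\<integral>\<^sup>+S. ennreal (3 / \<zeta>) * indicator B S \<partial>\<D>)"
    using B by (simp add: nn_integral_cmult_indicator)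
  also have "\<dots> \<le> (\<integral>\<^sup>+S. ?I S \<partial>\<D>)"
    by (intro nn_integral_mono) (auto simp: B_def indicator_def)
  also note I3
  finally have "ennreal (3 / \<zeta> * measure \<D> B) \<le> ennreal 3"
    using \<open>0 < \<zeta>\<close> by (subst ennreal_mult) (auto simp: D.emeasure_eq_measure simp del: ennreal_numeral)
  then have "measure \<D> B \<le> \<zeta>"
    using \<open>0 < \<zeta>\<close> by (simp add: field_simps del: ennreal_numeral)
  then have "1 - \<zeta> \<le> measure \<D> (space \<D> - B)"
    using B by (simp add: D.prob_compl)
  moreover have "?I S \<le> ennreal (3 / \<zeta>)" if "S \<in> space \<D> - B" for S
    using that by (auto simp: B_def)
  ultimately show ?thesis
    using B by (intro bexI[of _ "space \<D> - B"]) (auto simp: E_def)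
qed

text \<open>In \<open>subgaussian_loss_0\<close> the null set of samples depends on
  \<open>w\<close>. Exchanging the two quantifiers makes it independent of \<open>w\<close>, at the
  price of a \<open>\<pi>\<close>-null set of \<open>w\<close>, which no posterior with a density
  charges.\<close>

lemma null_gap_event:
  assumes z: "prob_space \<mu>\<^sub>z" and n: "1 \<le> n"
    and l[measurable]: "(\<lambda>(w, z). l w z) \<in> borel_measurable (borel \<Otimes>\<^sub>M \<mu>\<^sub>z)"
    and \<pi>: "prob_space \<pi>" and [measurable_cong]: "sets \<pi> = sets borel"
    and sub: "subgaussian_loss \<mu>\<^sub>z l 0"
  defines "\<D> \<equiv> \<Pi>\<^sub>M i\<in>{..<n}. \<mu>\<^sub>z"
  shows "\<exists>A\<in>sets \<D>. measure \<D> A = 1 \<and> (\<forall>S\<in>A. AE w in \<pi>. gen_gap \<mu>\<^sub>z n l S w = 0)"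
proof -
  interpret D: prob_space \<D>
    unfolding \<D>_def using z by (intro prob_space_PiM)
  interpret \<pi>: prob_space \<pi> by fact
  interpret pair_sigma_finite \<D> \<pi> ..
  have [measurable]: "(\<lambda>(w, S). gen_gap \<mu>\<^sub>z n l S w) \<in> borel_measurable (borel \<Otimes>\<^sub>M \<D>)"
    unfolding \<D>_def by (rule measurable_gen_gap[OF z l])
  have "AE S in \<D>. AE w in \<pi>. gen_gap \<mu>\<^sub>z n l S w = 0"
    using subgaussian_loss_0[OF z n l sub, folded \<D>_def]
    by (subst AE_commute) auto
  then obtain A where A: "A \<in> D.events" "D.prob A = 1"
      "\<And>S. S \<in> A \<Longrightarrow> AE w in \<pi>. gen_gap \<mu>\<^sub>z n l S w = 0"
    by (rule D.AE_E_prob) auto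
  then show ?thesis by blast
qed

section \<open>Entropy and the Donsker-Varadhan inequality\<close>

text \<open>The convex function \<open>\<Phi>\<close> lies above its tangent at \<open>b\<close>; in
  other form, this is \<open>ln y \<le> y - 1\<close> at \<open>y = b / a\<close>. Donsker and
  Varadhan's inequality, the convexity of \<open>\<Phi>\<close> and the bound on the mixed term all
  come from it.\<close>

lemma mult_ln_le:
  fixes a b :: real
  assumes "0 \<le> a" "0 < b"
  shows "a * ln b \<le> \<Phi> a + b - a"
proof (cases "a = 0")
  case False
  with assms have "0 < a" by simp
  then have "a * ln (b / a) \<le> a * (b / a - 1)"
    using assms by (intro mult_left_mono ln_le_minus_one) auto
  then show ?thesis
    using \<open>0 < a\<close> assms by (simp add: \<Phi>_def ln_div algebra_simps)
qed (use assms in \<open>simp add: \<Phi>_def\<close>)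

lemma measurable_Phi [measurable]: "\<Phi> \<in> borel_measurable borel"
  unfolding \<Phi>_def[abs_def] by measurable

lemma integrable_norm_bound:
  fixes f :: "'a \<Rightarrow> real" and g :: "'a \<Rightarrow> real"
  assumes "integrable M g" "f \<in> borel_measurable M" "\<And>x. x \<in> space M \<Longrightarrow> norm (f x) \<le> g x"
  shows "integrable M f"
  using assms(1,2) by (rule Bochner_Integration.integrable_bound) (intro AE_I2, use assms(3) in force)

text \<open>A pointwise inequality is integrated: \<open>mult_ln_le\<close> at
  \<open>b = exp (f x) / C\<close>. The integral of \<open>b\<close> is at most 1 and is absorbed by
  that of \<open>- u\<close>. As \<open>f\<close> is nonnegative, the same upper bound dominates the
  absolute value of \<open>u * f\<close> and yields integrability.\<close>

lemma donsker_varadhan: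
  fixes f u :: "'a \<Rightarrow> real"
  assumes "prob_space \<pi>"
    and [measurable]: "u \<in> borel_measurable \<pi>" "f \<in> borel_measurable \<pi>"
    and u: "\<And>x. 0 \<le> u x" "integrable \<pi> u" "(\<integral>x. u x \<partial>\<pi>) = 1" "integrable \<pi> (\<lambda>x. \<Phi> (u x))"
    and f: "\<And>x. 0 \<le> f x" and C: "0 < C" "(\<integral>\<^sup>+x. ennreal (exp (f x)) \<partial>\<pi>) \<le> ennreal C"
  shows "integrable \<pi> (\<lambda>x. u x * f x)"
    and "(\<integral>x. u x * f x \<partial>\<pi>) \<le> (\<integral>x. \<Phi> (u x) \<partial>\<pi>) + ln C"
proof -
  interpret prob_space \<pi> by fact
  have e: "integrable \<pi> (\<lambda>x. exp (f x))"
    using C(2) by (intro integrableI_nonneg) (auto simp: less_top[symmetric] top_unique)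
  have e_le: "(\<integral>x. exp (f x) \<partial>\<pi>) \<le> C"
    using C by (subst (asm) nn_integral_eq_integral[OF e]) auto
  have le: "u x * f x \<le> \<Phi> (u x) + exp (f x) / C - u x + u x * ln C" for x
    using mult_ln_le[of "u x" "exp (f x) / C"] u(1)[of x] C(1)
    by (simp add: ln_div algebra_simps)
  have i: "integrable \<pi> (\<lambda>x. \<Phi> (u x) + exp (f x) / C - u x + u x * ln C)"
    using e u by auto
  show int: "integrable \<pi> (\<lambda>x. u x * f x)"
    using le u(1) f by (intro integrable_norm_bound[OF i]) auto
  have "(\<integral>x. u x * f x \<partial>\<pi>) \<le> (\<integral>x. \<Phi> (u x) + exp (f x) / C - u x + u x * ln C \<partial>\<pi>)"
    by (intro integral_mono int i le)
  also have "\<dots> = (\<integral>x. \<Phi> (u x) \<partial>\<pi>) + (\<integral>x. exp (f x) \<partial>\<pi>) / C - 1 + ln C"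
    using e u by simp
  also have "\<dots> \<le> (\<integral>x. \<Phi> (u x) \<partial>\<pi>) + ln C"
    using e_le C by simp
  finally show "(\<integral>x. u x * f x \<partial>\<pi>) \<le> (\<integral>x. \<Phi> (u x) \<partial>\<pi>) + ln C" .
qed

text \<open>Donsker and Varadhan's inequality is applied to \<open>a * G\<^sup>2\<close>, and the
  variance of \<open>G\<close> under the density \<open>u\<close> being nonnegative passes from the
  second moment to the square of the mean. Integrability of \<open>u * G\<close> comes from
  \<open>\<bar>G\<bar> \<le> 1 + G\<^sup>2\<close>.\<close>

lemma square_moment_bound:
  fixes G u :: "'a \<Rightarrow> real"
  assumes \<pi>: "prob_space \<pi>"
    and [measurable]: "u \<in> borel_measurable \<pi>" "G \<in> borel_measurable \<pi>"
    and u: "\<And>x. 0 \<le> u x" "integrable \<pi> u" "(\<integral>x. u x \<partial>\<pi>) = 1" "integrable \<pi> (\<lambda>x. \<Phi> (u x))"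
    and a: "0 < a" and C: "0 < C" "(\<integral>\<^sup>+x. ennreal (exp (a * (G x)\<^sup>2)) \<partial>\<pi>) \<le> ennreal C"
  shows "integrable \<pi> (\<lambda>x. u x * G x)"
    and "(\<integral>x. u x * G x \<partial>\<pi>) \<le> sqrt (((\<integral>x. \<Phi> (u x) \<partial>\<pi>) + ln C) / a)"
proof -
  have f: "(\<lambda>x. a * (G x)\<^sup>2) \<in> borel_measurable \<pi>" "\<And>x. 0 \<le> a * (G x)\<^sup>2"
    using a by simp_all
  note dv = donsker_varadhan[OF \<pi> assms(2) f(1) u f(2) C]
  have "integrable \<pi> (\<lambda>x. a * (u x * (G x)\<^sup>2))"
    using dv(1) by (simp add: mult.left_commute)
  then have int2: "integrable \<pi> (\<lambda>x. u x * (G x)\<^sup>2)"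
    using a by simp
  have "\<bar>G x\<bar> \<le> 1 + (G x)\<^sup>2" for x
    using zero_le_power2[of "\<bar>G x\<bar> - 1"] by (simp add: power2_diff)
  then have "u x * \<bar>G x\<bar> \<le> u x * (1 + (G x)\<^sup>2)" for x
    using u(1) by (intro mult_left_mono)
  then have le: "norm (u x * G x) \<le> u x + u x * (G x)\<^sup>2" for x
    using u(1)[of x] by (simp add: abs_mult ring_distribs)
  have "integrable \<pi> (\<lambda>x. u x + u x * (G x)\<^sup>2)"
    using int2 u(2) by simp
  then show int: "integrable \<pi> (\<lambda>x. u x * G x)"
    by (rule integrable_norm_bound) (use le in auto)
  define m where "m = (\<integral>x. u x * G x \<partial>\<pi>)"
  have "0 \<le> (\<integral>x. u x * (G x - m)\<^sup>2 \<partial>\<pi>)"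
    using u(1) by simp
  also have "(\<lambda>x. u x * (G x - m)\<^sup>2) = (\<lambda>x. u x * (G x)\<^sup>2 - 2 * m * (u x * G x) + m\<^sup>2 * u x)"
    by (auto simp: power2_diff algebra_simps)
  also have "(\<integral>x. u x * (G x)\<^sup>2 - 2 * m * (u x * G x) + m\<^sup>2 * u x \<partial>\<pi>) = (\<integral>x. u x * (G x)\<^sup>2 \<partial>\<pi>) - m\<^sup>2"
    using int2 int u by (simp add: m_def[symmetric] power2_eq_square)
  finally have "a * m\<^sup>2 \<le> a * (\<integral>x. u x * (G x)\<^sup>2 \<partial>\<pi>)"
    using a by simp
  also have "\<dots> = (\<integral>x. u x * (a * (G x)\<^sup>2) \<partial>\<pi>)"
    by (simp add: mult.left_commute)
  also note dv(2)
  finally have "m\<^sup>2 \<le> ((\<integral>x. \<Phi> (u x) \<partial>\<pi>) + ln C) / a"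
    using a by (simp add: field_simps)
  then show "(\<integral>x. u x * G x \<partial>\<pi>) \<le> sqrt (((\<integral>x. \<Phi> (u x) \<partial>\<pi>) + ln C) / a)"
    unfolding m_def[symmetric] by (rule real_le_rsqrt)
qed

section \<open>Convexity of \<open>\<Phi>\<close> and stability of its integrability\<close>

lemma Phi_ge: "0 \<le> x \<Longrightarrow> -1 \<le> \<Phi> x"
  using mult_ln_le[of x 1] by simp

lemma Phi_mult: "0 < c \<Longrightarrow> 0 \<le> x \<Longrightarrow> \<Phi> (c * x) = c * \<Phi> x + c * ln c * x"
  by (cases "x = 0") (auto simp: \<Phi>_def ln_mult algebra_simps)

text \<open>The tangent bounds at the midpoint for \<open>a\<close> and for \<open>b\<close> are
  added. A tangent exists only at a positive point, hence the separate case.\<close>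

lemma Phi_midpoint:
  assumes "0 \<le> a" "0 \<le> b"
  shows "2 * \<Phi> ((a + b) / 2) \<le> \<Phi> a + \<Phi> b"
proof (cases "a + b = 0")
  case True
  with assms show ?thesis by (simp add: \<Phi>_def add_nonneg_eq_0_iff)
next
  case False
  with assms have "0 < (a + b) / 2" by simp
  from mult_ln_le[OF assms(1) this] mult_ln_le[OF assms(2) this] show ?thesis
    by (simp add: \<Phi>_def field_simps)
qed

lemma (in finite_measure) integrable_Phi_mult:
  assumes "0 < c" "\<And>x. 0 \<le> f x" "integrable M f" "integrable M (\<lambda>x. \<Phi> (f x))"
  shows "integrable M (\<lambda>x. \<Phi> (c * f x))"
  using assms by (simp add: Phi_mult)

text \<open>Convexity bounds \<open>\<Phi>\<close> of the average from above and -1 bounds it from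
  below; by \<open>Phi_mult\<close>, doubling the argument costs only a factor and a linear
  term.\<close>

lemma (in finite_measure) integrable_Phi_add:
  assumes f: "\<And>x. 0 \<le> f x" "integrable M f" "integrable M (\<lambda>x. \<Phi> (f x))"
    and g: "\<And>x. 0 \<le> g x" "integrable M g" "integrable M (\<lambda>x. \<Phi> (g x))"
  shows "integrable M (\<lambda>x. \<Phi> (f x + g x))"
proof -
  have [measurable]: "f \<in> borel_measurable M" "g \<in> borel_measurable M"
    using f(2) g(2) by auto
  have le: "\<bar>\<Phi> ((f x + g x) / 2)\<bar> \<le> \<bar>\<Phi> (f x)\<bar> + \<bar>\<Phi> (g x)\<bar> + 1" for x
    using Phi_midpoint[OF f(1) g(1), of x x] Phi_ge[of "(f x + g x) / 2"] f(1)[of x] g(1)[of x] by simp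
  have "integrable M (\<lambda>x. \<bar>\<Phi> (f x)\<bar> + \<bar>\<Phi> (g x)\<bar> + 1)"
    using f(3) g(3) by simp
  then have "integrable M (\<lambda>x. \<Phi> ((f x + g x) / 2))"
    by (rule integrable_norm_bound) (use le in auto)
  then have "integrable M (\<lambda>x. \<Phi> (2 * ((f x + g x) / 2)))"
    using f g by (intro integrable_Phi_mult) auto
  also have "(\<lambda>x. \<Phi> (2 * ((f x + g x) / 2))) = (\<lambda>x. \<Phi> (f x + g x))"
    by (intro ext arg_cong[where f = \<Phi>]) simp
  finally show ?thesis .
qed

section \<open>Integration against kernels\<close>

text \<open>The Bochner integral is 0 where the integrand is not integrable, so it is a case
  distinction over a measurable set of \<open>x\<close> between 0 and a difference of nonnegative
  kernel integrals.\<close>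

lemma borel_measurable_kernel_integral:
  fixes F :: "'a \<Rightarrow> 'b \<Rightarrow> real"
  assumes F[measurable]: "(\<lambda>(x, y). F x y) \<in> borel_measurable (M \<Otimes>\<^sub>M N)"
    and K[measurable]: "K \<in> M \<rightarrow>\<^sub>M subprob_algebra N"
  shows "(\<lambda>x. \<integral>y. F x y \<partial>K x) \<in> borel_measurable M"
proof -
  have [measurable]: "(\<lambda>x. \<integral>\<^sup>+y. ennreal \<bar>F x y\<bar> \<partial>K x) \<in> borel_measurable M"
      "(\<lambda>x. \<integral>\<^sup>+y. ennreal (F x y) \<partial>K x) \<in> borel_measurable M"
      "(\<lambda>x. \<integral>\<^sup>+y. ennreal (- F x y) \<partial>K x) \<in> borel_measurable M"
    by (rule nn_integral_measurable_subprob_algebra2[OF _ K], measurable)+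
  have "(\<integral>y. F x y \<partial>K x) = (if (\<integral>\<^sup>+y. ennreal \<bar>F x y\<bar> \<partial>K x) < \<infinity>
      then enn2real (\<integral>\<^sup>+y. ennreal (F x y) \<partial>K x) - enn2real (\<integral>\<^sup>+y. ennreal (- F x y) \<partial>K x) else 0)"
    if "x \<in> space M" for x
  proof -
    have "F x \<in> borel_measurable N"
      using measurable_Pair2[OF F that] by simp
    then have "F x \<in> borel_measurable (K x)"
      using sets_kernel[OF K that] by (simp cong: measurable_cong_sets)
    then show ?thesis
      by (auto simp: integrable_iff_bounded real_lebesgue_integral_def not_integrable_integral_eq)
  qed
  then show ?thesis
    by (simp cong: measurable_cong)
qed

text \<open>Fubini's theorem for a kernel. The last conclusion has the shape of
  \<open>log_dirichlet\<close>, which it turns into an ordinary iterated integral.\<close>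

lemma kernel_integral:
  fixes F :: "'a \<Rightarrow> 'b \<Rightarrow> real"
  assumes F[measurable]: "(\<lambda>(x, y). F x y) \<in> borel_measurable (M \<Otimes>\<^sub>M N)"
    and K[measurable]: "K \<in> M \<rightarrow>\<^sub>M subprob_algebra N"
    and fin: "(\<integral>\<^sup>+x. \<integral>\<^sup>+y. ennreal \<bar>F x y\<bar> \<partial>K x \<partial>M) < \<infinity>"
  shows kernel_integral_AE: "AE x in M. integrable (K x) (F x)"
    and integrable_kernel_integral: "integrable M (\<lambda>x. \<integral>y. F x y \<partial>K x)"
    and kernel_integral_eq: "ereal (\<integral>x. \<integral>y. F x y \<partial>K x \<partial>M) =
      enn2ereal (\<integral>\<^sup>+x. \<integral>\<^sup>+y. ennreal (F x y) \<partial>K x \<partial>M)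
      - enn2ereal (\<integral>\<^sup>+x. \<integral>\<^sup>+y. ennreal (- F x y) \<partial>K x \<partial>M)"
proof -
  have [measurable]: "(\<lambda>x. \<integral>\<^sup>+y. ennreal \<bar>F x y\<bar> \<partial>K x) \<in> borel_measurable M"
      "(\<lambda>x. \<integral>\<^sup>+y. ennreal (F x y) \<partial>K x) \<in> borel_measurable M"
      "(\<lambda>x. \<integral>\<^sup>+y. ennreal (- F x y) \<partial>K x) \<in> borel_measurable M"
    by (rule nn_integral_measurable_subprob_algebra2[OF _ K], measurable)+
  have Fx: "F x \<in> borel_measurable (K x)" if "x \<in> space M" for x
    using measurable_Pair2[OF F that] sets_kernel[OF K that] by (simp cong: measurable_cong_sets)
  have "AE x in M. (\<integral>\<^sup>+y. ennreal \<bar>F x y\<bar> \<partial>K x) \<noteq> \<infinity>"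
    using fin by (intro nn_integral_PInf_AE) auto
  then show AE: "AE x in M. integrable (K x) (F x)"
    by (rule AE_mp) (auto intro!: AE_I2 simp: integrable_iff_bounded Fx less_top)
  let ?p = "\<lambda>x. \<integral>\<^sup>+y. ennreal (F x y) \<partial>K x" and ?m = "\<lambda>x. \<integral>\<^sup>+y. ennreal (- F x y) \<partial>K x"
  have fin_p: "(\<integral>\<^sup>+x. ?p x \<partial>M) < \<infinity>" and fin_m: "(\<integral>\<^sup>+x. ?m x \<partial>M) < \<infinity>"
    by (rule le_less_trans[OF _ fin], intro nn_integral_mono ennreal_leI, simp)+
  have AE_p: "AE x in M. ?p x \<noteq> \<infinity>" and AE_m: "AE x in M. ?m x \<noteq> \<infinity>"
    using fin_p fin_m by (intro nn_integral_PInf_AE; simp)+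
  \<comment> \<open>\<open>enn2real\<close> sends infinity to 0, which matters only on the null set
    excluded by \<open>AE_p\<close>.\<close>
  have nn_p: "(\<integral>\<^sup>+x. ennreal (enn2real (?p x)) \<partial>M) = (\<integral>\<^sup>+x. ?p x \<partial>M)"
    using AE_p by (intro nn_integral_cong_AE) (auto simp: less_top)
  have nn_m: "(\<integral>\<^sup>+x. ennreal (enn2real (?m x)) \<partial>M) = (\<integral>\<^sup>+x. ?m x \<partial>M)"
    using AE_m by (intro nn_integral_cong_AE) (auto simp: less_top)
  have int: "integrable M (\<lambda>x. enn2real (?p x))" "integrable M (\<lambda>x. enn2real (?m x))"
    using fin_p fin_m nn_p nn_m by (auto intro!: integrableI_nonneg)
  have eq: "AE x in M. (\<integral>y. F x y \<partial>K x) = enn2real (?p x) - enn2real (?m x)"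
    using AE by eventually_elim (simp add: real_lebesgue_integral_def)
  have [measurable]: "(\<lambda>x. \<integral>y. F x y \<partial>K x) \<in> borel_measurable M"
    by (rule borel_measurable_kernel_integral[OF F K])
  show "integrable M (\<lambda>x. \<integral>y. F x y \<partial>K x)"
    using int eq by (subst integrable_cong_AE[OF _ _ eq]) auto
  have "(\<integral>x. \<integral>y. F x y \<partial>K x \<partial>M) = (\<integral>x. enn2real (?p x) \<partial>M) - (\<integral>x. enn2real (?m x) \<partial>M)"
    using int by (subst integral_cong_AE[OF _ _ eq]) auto
  also have "(\<integral>x. enn2real (?p x) \<partial>M) = enn2real (\<integral>\<^sup>+x. ?p x \<partial>M)"
    by (subst integral_eq_nn_integral) (auto simp: nn_p)
  also have "(\<integral>x. enn2real (?m x) \<partial>M) = enn2real (\<integral>\<^sup>+x. ?m x \<partial>M)"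
    by (subst integral_eq_nn_integral) (auto simp: nn_m)
  finally show "ereal (\<integral>x. \<integral>y. F x y \<partial>K x \<partial>M) =
      enn2ereal (\<integral>\<^sup>+x. \<integral>\<^sup>+y. ennreal (F x y) \<partial>K x \<partial>M)
      - enn2ereal (\<integral>\<^sup>+x. \<integral>\<^sup>+y. ennreal (- F x y) \<partial>K x \<partial>M)"
    using fin_p fin_m
    by (cases "\<integral>\<^sup>+x. ?p x \<partial>M"; cases "\<integral>\<^sup>+x. ?m x \<partial>M") auto
qed

lemma integral_bind_integrable:
  fixes f :: "'b \<Rightarrow> real"
  assumes f[measurable]: "f \<in> borel_measurable N"
    and K[measurable]: "K \<in> M \<rightarrow>\<^sub>M subprob_algebra N" and "space M \<noteq> {}"
    and int: "integrable (M \<bind> K) f"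
  shows "AE x in M. integrable (K x) f"
    and "integrable M (\<lambda>x. \<integral>y. f y \<partial>K x)"
    and "(\<integral>x. \<integral>y. f y \<partial>K x \<partial>M) = (\<integral>y. f y \<partial>(M \<bind> K))"
proof -
  have F: "(\<lambda>(x, y). f y) \<in> borel_measurable (M \<Otimes>\<^sub>M N)"
    by measurable
  have fin: "(\<integral>\<^sup>+x. \<integral>\<^sup>+y. ennreal \<bar>f y\<bar> \<partial>K x \<partial>M) < \<infinity>"
    using int by (simp add: integrable_iff_bounded nn_integral_bind[OF _ K])
  show "AE x in M. integrable (K x) f" "integrable M (\<lambda>x. \<integral>y. f y \<partial>K x)"
    by (fact kernel_integral_AE[OF F K fin] integrable_kernel_integral[OF F K fin])+
  have "ereal (\<integral>x. \<integral>y. f y \<partial>K x \<partial>M) =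
      enn2ereal (\<integral>\<^sup>+y. ennreal (f y) \<partial>(M \<bind> K)) - enn2ereal (\<integral>\<^sup>+y. ennreal (- f y) \<partial>(M \<bind> K))"
    unfolding kernel_integral_eq[OF F K fin] by (simp add: nn_integral_bind[OF _ K])
  also have "\<dots> = ereal (\<integral>y. f y \<partial>(M \<bind> K))"
    using int unfolding real_integrable_def real_lebesgue_integral_def[OF int]
    by (cases "\<integral>\<^sup>+y. ennreal (f y) \<partial>(M \<bind> K)"; cases "\<integral>\<^sup>+y. ennreal (- f y) \<partial>(M \<bind> K)") auto
  finally show "(\<integral>x. \<integral>y. f y \<partial>K x \<partial>M) = (\<integral>y. f y \<partial>(M \<bind> K))"
    by simp
qed

section \<open>Poisson mixtures of densities\<close>

text \<open>The mean of \<open>a\<close> at a Poisson variable with mean \<open>t\<close>. The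
  prefactor stands outside so that the rest is a power series in \<open>t\<close> with coefficients
  \<open>a k / fact k\<close>, to be differentiated termwise.\<close>

definition poisson_mix :: "real \<Rightarrow> (nat \<Rightarrow> real) \<Rightarrow> real" where
  "poisson_mix t a = exp (- t) * (\<Sum>k. t ^ k / fact k * a k)"

lemma measurable_poisson_mix [measurable]:
  assumes [measurable]: "f \<in> borel_measurable M" "\<And>k. (\<lambda>x. a x k) \<in> borel_measurable M"
  shows "(\<lambda>x. poisson_mix (f x) (a x)) \<in> borel_measurable M"
  unfolding poisson_mix_def by measurable

context
  fixes a :: "nat \<Rightarrow> real"
  assumes summable: "\<And>t. summable (\<lambda>k. t ^ k / fact k * a k)"
    and nonneg: "\<And>k. 0 \<le> a k"
begin

lemma diffs_poisson: "diffs (\<lambda>k. a k / fact k) = (\<lambda>k. a (Suc k) / fact k)"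
  by (simp add: diffs_def fun_eq_iff del: of_nat_Suc)

lemma summable_poisson: "summable (\<lambda>k. a k / fact k * t ^ k)"
  using summable[of t] by (simp add: mult_ac)

lemma summable_poisson_Suc: "summable (\<lambda>k. t ^ k / fact k * a (Suc k))"
  using termdiff_converges_all[of "\<lambda>k. a k / fact k" t] summable_poisson
  by (simp add: diffs_poisson mult_ac)

text \<open>Differentiating an exponential generating series shifts its coefficients, and the
  prefactor contributes minus the function itself. For the laws of a chain, the shift is one more
  step of the kernel.\<close>

lemma poisson_mix_deriv:
  "((\<lambda>t. poisson_mix t a) has_real_derivative
     (poisson_mix t (\<lambda>k. a (Suc k)) - poisson_mix t a)) (at t)"
proof -
  have "((\<lambda>t. \<Sum>k. a k / fact k * t ^ k) has_real_derivative (\<Sum>k. a (Suc k) / fact k * t ^ k)) (at t)"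
    using termdiffs_strong_converges_everywhere[of "\<lambda>k. a k / fact k" t] summable_poisson
    by (simp add: diffs_poisson)
  then show ?thesis
    unfolding poisson_mix_def by (auto intro!: derivative_eq_intros simp: mult_ac algebra_simps)
qed

lemma poisson_mix_nonneg: "0 \<le> t \<Longrightarrow> 0 \<le> poisson_mix t a"
  unfolding poisson_mix_def using nonneg by (intro mult_nonneg_nonneg suminf_nonneg summable) auto

lemma poisson_mix_ge: "0 \<le> t \<Longrightarrow> exp (- t) * a 0 \<le> poisson_mix t a"
  unfolding poisson_mix_def
  using sum_le_suminf[OF summable[of t], of "{0}"] nonneg by (intro mult_left_mono) auto

lemma poisson_mix_le:
  assumes "0 \<le> t" "t \<le> T"
  shows "poisson_mix t a \<le> exp T * poisson_mix T a"
proof -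
  have "(\<Sum>k. t ^ k / fact k * a k) \<le> (\<Sum>k. T ^ k / fact k * a k)"
    using assms nonneg by (intro suminf_le summable mult_right_mono divide_right_mono power_mono) auto
  moreover have "0 \<le> (\<Sum>k. t ^ k / fact k * a k)"
    using assms nonneg by (intro suminf_nonneg summable) auto
  ultimately have "exp (- t) * (\<Sum>k. t ^ k / fact k * a k) \<le> 1 * (\<Sum>k. T ^ k / fact k * a k)"
    using assms by (intro mult_mono) auto
  then show ?thesis
    by (simp add: poisson_mix_def mult_exp_exp flip: mult.assoc)
qed

end

text \<open>(H.2) controls only the shifted mixture. The unshifted one is recovered from it and the
  initial term, since \<open>1 / fact (Suc k) \<le> 1 / fact k\<close> in all later terms.\<close>

lemma poisson_mix_split:
  assumes "\<And>t. summable (\<lambda>k. t ^ k / fact k * a k)" "\<And>k. 0 \<le> a k" and t: "0 \<le> t"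
  shows "poisson_mix t a \<le> a 0 + t * poisson_mix t (\<lambda>k. a (Suc k))"
proof -
  note sS = summable_poisson_Suc[OF assms(1,2), of t]
  have sS': "summable (\<lambda>k. t ^ Suc k / fact (Suc k) * a (Suc k))"
    using assms(1)[of t] by (subst summable_Suc_iff)
  have "(\<Sum>k. t ^ k / fact k * a k) = a 0 + (\<Sum>k. t ^ Suc k / fact (Suc k) * a (Suc k))"
    using suminf_split_head[OF assms(1)[of t]] by simp
  also have "(\<Sum>k. t ^ Suc k / fact (Suc k) * a (Suc k)) \<le> (\<Sum>k. t * (t ^ k / fact k * a (Suc k)))"
  proof (intro suminf_le sS' summable_mult sS)
    fix k
    have "t ^ Suc k * a (Suc k) / fact (Suc k) \<le> t ^ Suc k * a (Suc k) / fact k"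
      using t assms(2)[of "Suc k"] by (intro divide_left_mono fact_mono) auto
    then show "t ^ Suc k / fact (Suc k) * a (Suc k) \<le> t * (t ^ k / fact k * a (Suc k))"
      by (simp add: mult_ac del: fact_Suc)
  qed
  also have "\<dots> = t * (\<Sum>k. t ^ k / fact k * a (Suc k))"
    by (rule suminf_mult[OF sS])
  finally have "poisson_mix t a \<le> exp (- t) * (a 0 + t * (\<Sum>k. t ^ k / fact k * a (Suc k)))"
    unfolding poisson_mix_def by (intro mult_left_mono) auto
  also have "\<dots> \<le> a 0 + t * poisson_mix t (\<lambda>k. a (Suc k))"
    using t assms(2)[of 0] mult_right_mono[of "exp (- t)" 1 "a 0"] by (simp add: poisson_mix_def algebra_simps)
  finally show ?thesis .
qed

text \<open>\<open>w k\<close> stands for the density of the law of the k-th state of the jump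
  chain. The pointwise conditions hold everywhere, not just almost everywhere, so that
  \<open>u t x\<close> is differentiable in \<open>t\<close> at each \<open>x\<close> and no null
  set varies with \<open>t\<close>.\<close>

locale jump_densities = prob_space \<pi> for \<pi> :: "'a::topological_space measure" +
  fixes w :: "nat \<Rightarrow> 'a \<Rightarrow> real" and c :: real
  assumes sets_pi [measurable_cong]: "sets \<pi> = sets borel"
    and w_meas [measurable]: "\<And>k. w k \<in> borel_measurable borel"
    and w_nonneg: "\<And>k x. 0 \<le> w k x"
    and w_0: "0 < c" "\<And>x. c \<le> w 0 x"
    and w_summable: "\<And>t x. summable (\<lambda>k. t ^ k / fact k * w k x)"
    and nn_integral_w: "\<And>k. (\<integral>\<^sup>+x. ennreal (w k x) \<partial>\<pi>) = 1"
begin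

definition u :: "real \<Rightarrow> 'a \<Rightarrow> real" where
  "u t x = poisson_mix t (\<lambda>k. w k x)"

text \<open>The image of \<open>u t\<close> under the dual operator of the posterior kernel, by
  \<open>bind_density_u\<close>.\<close>

definition q :: "real \<Rightarrow> 'a \<Rightarrow> real" where
  "q t x = poisson_mix t (\<lambda>k. w (Suc k) x)"

lemma measurable_u_q [measurable]:
  assumes "f \<in> borel_measurable M" and g[measurable]: "g \<in> M \<rightarrow>\<^sub>M borel"
  shows "(\<lambda>x. u (f x) (g x)) \<in> borel_measurable M" "(\<lambda>x. q (f x) (g x)) \<in> borel_measurable M"
  unfolding u_def q_def
  by (intro measurable_poisson_mix assms measurable_compose[OF g w_meas])+

lemma w_Suc_summable: "summable (\<lambda>k. t ^ k / fact k * w (Suc k) x)"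
  using summable_poisson_Suc[OF w_summable w_nonneg] .

text \<open>Stated for any \<open>w'\<close> to cover both \<open>w\<close> and its shift; the
  weight \<open>h\<close> will be 1, the indicator of a set, or the probability that the kernel
  gives to a set.\<close>

lemma nn_integral_mix:
  assumes w'[measurable]: "\<And>k. w' k \<in> borel_measurable borel" and [measurable]: "h \<in> borel_measurable borel"
    and nonneg: "\<And>k x. 0 \<le> w' k x" and summable: "\<And>x. summable (\<lambda>k. t ^ k / fact k * w' k x)" and t: "0 \<le> t"
  shows "(\<integral>\<^sup>+x. ennreal (poisson_mix t (\<lambda>k. w' k x)) * h x \<partial>\<pi>)
    = (\<Sum>k. ennreal (exp (- t) * (t ^ k / fact k)) * (\<integral>\<^sup>+x. ennreal (w' k x) * h x \<partial>\<pi>))"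
proof -
  have "ennreal (poisson_mix t (\<lambda>k. w' k x)) * h x
      = (\<Sum>k. ennreal (exp (- t) * (t ^ k / fact k)) * (ennreal (w' k x) * h x))" for x
  proof -
    have "ennreal (poisson_mix t (\<lambda>k. w' k x)) = ennreal (\<Sum>k. exp (- t) * (t ^ k / fact k * w' k x))"
      unfolding poisson_mix_def by (subst suminf_mult[OF summable]) simp
    also have "\<dots> = (\<Sum>k. ennreal (exp (- t) * (t ^ k / fact k * w' k x)))"
      using t nonneg by (intro suminf_ennreal2[symmetric] summable_mult summable) auto
    also have "\<dots> = (\<Sum>k. ennreal (exp (- t) * (t ^ k / fact k)) * ennreal (w' k x))"
      using t nonneg by (simp add: mult.assoc flip: ennreal_mult)
    finally show ?thesis
      by (simp only: ennreal_suminf_multc[symmetric] mult.assoc)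
  qed
  then show ?thesis
    by (simp add: nn_integral_suminf nn_integral_cmult)
qed

lemma nn_integral_mix_1:
  assumes w'[measurable]: "\<And>k. w' k \<in> borel_measurable borel"
    and nonneg: "\<And>k x. 0 \<le> w' k x" and summable: "\<And>x. summable (\<lambda>k. t ^ k / fact k * w' k x)"
    and one: "\<And>k. (\<integral>\<^sup>+x. ennreal (w' k x) \<partial>\<pi>) = 1" and t: "0 \<le> t"
  shows "(\<integral>\<^sup>+x. ennreal (poisson_mix t (\<lambda>k. w' k x)) \<partial>\<pi>) = 1"
proof -
  have "(\<integral>\<^sup>+x. ennreal (poisson_mix t (\<lambda>k. w' k x)) \<partial>\<pi>) = (\<Sum>k. ennreal (exp (- t) * (t ^ k / fact k)))"
    using nn_integral_mix[OF w' _ nonneg summable t, of "\<lambda>_. 1"] by (simp add: one)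
  also have "\<dots> = ennreal (\<Sum>k. exp (- t) * (t ^ k / fact k))"
    using t summable_exp_generic[of t]
    by (intro suminf_ennreal2 summable_mult) (auto simp: field_simps scaleR_conv_of_real)
  also have "(\<Sum>k. exp (- t) * (t ^ k / fact k)) = exp (- t) * exp t"
    using summable_exp_generic[of t]
    by (subst suminf_mult) (auto simp: exp_def field_simps scaleR_conv_of_real)
  finally show ?thesis
    by (simp add: mult_exp_exp)
qed

lemma integral_1:
  assumes "f \<in> borel_measurable \<pi>" "\<And>x. 0 \<le> f x" "(\<integral>\<^sup>+x. ennreal (f x) \<partial>\<pi>) = 1"
  shows "integrable \<pi> f" "(\<integral>x. f x \<partial>\<pi>) = 1"
  using assms by (auto intro!: integrableI_nonneg simp: integral_eq_nn_integral)

context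
  fixes t :: real assumes t: "0 \<le> t"
begin

lemma u_nonneg: "0 \<le> u t x" and q_nonneg: "0 \<le> q t x"
  unfolding u_def q_def using t
  by (auto intro!: poisson_mix_nonneg w_summable w_nonneg w_Suc_summable)

lemma integrable_u: "integrable \<pi> (u t)" and integral_u: "(\<integral>x. u t x \<partial>\<pi>) = 1"
  using nn_integral_mix_1[of w, OF w_meas w_nonneg w_summable nn_integral_w t, folded u_def]
  by (auto intro!: integral_1 simp: u_nonneg)

lemma integrable_q: "integrable \<pi> (q t)" and integral_q: "(\<integral>x. q t x \<partial>\<pi>) = 1"
  using nn_integral_mix_1[of "\<lambda>k. w (Suc k)", OF w_meas w_nonneg w_Suc_summable nn_integral_w t, folded q_def]
  by (auto intro!: integral_1 simp: q_nonneg)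

text \<open>With probability \<open>exp (- t)\<close> no jump occurs up to time \<open>t\<close>, so
  this fraction of the initial density persists.\<close>

lemma u_ge: "exp (- t) * c \<le> u t x"
proof -
  have "exp (- t) * c \<le> exp (- t) * w 0 x"
    using w_0 by simp
  also have "\<dots> \<le> u t x"
    unfolding u_def using t by (intro poisson_mix_ge w_summable w_nonneg)
  finally show ?thesis .
qed

lemma u_pos: "0 < u t x"
  using u_ge[of x] w_0(1) by (meson exp_gt_zero mult_pos_pos order_less_le_trans)

end

lemma u_deriv: "((\<lambda>t. u t x) has_real_derivative (q t x - u t x)) (at t)"
  unfolding u_def q_def by (intro poisson_mix_deriv w_summable w_nonneg)

lemma u_0: "u 0 x = w 0 x"
proof -
  have "u 0 x \<le> w 0 x"
    using poisson_mix_split[OF w_summable w_nonneg, of 0 x] by (simp add: u_def)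
  moreover have "w 0 x \<le> u 0 x"
    using poisson_mix_ge[OF w_summable w_nonneg, of 0 x] by (simp add: u_def)
  ultimately show ?thesis by simp
qed

lemma emeasure_density_u:
  assumes "0 \<le> t" and A[measurable]: "A \<in> sets borel"
  shows "emeasure (density \<pi> (u t)) A
    = (\<Sum>k. ennreal (exp (- t) * (t ^ k / fact k)) * emeasure (density \<pi> (w k)) A)"
  using nn_integral_mix[OF w_meas _ w_nonneg w_summable assms(1), of "indicator A", folded u_def]
  by (simp add: emeasure_density)

text \<open>A kernel acts linearly on measures, hence passes through the countable mixture and
  raises each index by one.\<close>

lemma bind_density_u:
  assumes t: "0 \<le> t" and Q[measurable]: "Q \<in> borel \<rightarrow>\<^sub>M subprob_algebra borel"
    and step: "\<And>k. density \<pi> (w k) \<bind> Q = density \<pi> (w (Suc k))"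
  shows "density \<pi> (u t) \<bind> Q = density \<pi> (q t)"
proof (rule measure_eqI)
  have sp: "space \<pi> \<noteq> {}" by (rule not_empty)
  have Q': "Q \<in> density \<pi> f \<rightarrow>\<^sub>M subprob_algebra borel" for f
    by measurable
  have sets: "sets (density \<pi> f \<bind> Q) = sets borel" for f
    by (rule sets_bind[OF sets_kernel[OF Q']]) (simp_all add: sp)
  then show "sets (density \<pi> (u t) \<bind> Q) = sets (density \<pi> (q t))"
    by (simp add: sets_pi)
  fix A assume "A \<in> sets (density \<pi> (u t) \<bind> Q)"
  then have A[measurable]: "A \<in> sets borel"
    by (simp add: sets)
  have bind: "emeasure (density \<pi> f \<bind> Q) A = (\<integral>\<^sup>+x. f x * emeasure (Q x) A \<partial>\<pi>)"
    if [measurable]: "f \<in> borel_measurable borel" for f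
    by (subst emeasure_bind[OF _ Q' A]) (simp_all add: sp nn_integral_density)
  have "emeasure (density \<pi> (u t) \<bind> Q) A = (\<integral>\<^sup>+x. ennreal (u t x) * emeasure (Q x) A \<partial>\<pi>)"
    by (rule bind) measurable
  also have "\<dots> = (\<Sum>k. ennreal (exp (- t) * (t ^ k / fact k)) * (\<integral>\<^sup>+x. ennreal (w k x) * emeasure (Q x) A \<partial>\<pi>))"
    unfolding u_def by (rule nn_integral_mix[OF w_meas _ w_nonneg w_summable t]) measurable
  also have "\<dots> = (\<Sum>k. ennreal (exp (- t) * (t ^ k / fact k)) * (\<integral>\<^sup>+x. ennreal (w (Suc k) x) * indicator A x \<partial>\<pi>))"
    by (simp add: bind[symmetric] step emeasure_density)
  also have "\<dots> = emeasure (density \<pi> (q t)) A"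
    using nn_integral_mix[OF w_meas _ w_nonneg w_Suc_summable t, of "indicator A", folded q_def]
    by (simp add: emeasure_density)
  finally show "emeasure (density \<pi> (u t) \<bind> Q) A = emeasure (density \<pi> (q t)) A" .
qed

end

section \<open>Decay of the entropy\<close>

text \<open>On \<open>[0, T]\<close> all densities are dominated by one function \<open>g\<close> with \<open>\<Phi> g \<in> L\<^sup>1(\<pi>)\<close>, because the
  Poisson weights at time \<open>t\<close> are at most \<open>exp T\<close> times those at time \<open>T\<close>.\<close>

locale jump_densities_horizon = jump_densities +
  fixes T :: real
  assumes T: "0 < T"
    and integrable_Phi_w0: "integrable \<pi> (\<lambda>x. \<Phi> (w 0 x))"
    and integrable_Phi_q: "integrable \<pi> (\<lambda>x. \<Phi> (q T x))"
begin

text \<open>\<open>u t \<le> w 0 + t * q t\<close> and \<open>q t \<le> exp T * q T\<close>. The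
  factor \<open>T + 1\<close> exceeds both \<open>t\<close> and 1, so that a single function
  dominates \<open>u t\<close> and \<open>q t\<close>.\<close>

definition g :: "'a \<Rightarrow> real" where
  "g x = w 0 x + (T + 1) * exp T * q T x"

text \<open>The logarithm of \<open>u t\<close> lies between those of its lower bound
  \<open>exp (- T) * c\<close> and its upper bound \<open>g\<close>. The product
  \<open>g * L\<close> is integrable because it is \<open>\<bar>\<Phi> g\<bar>\<close> plus a
  multiple of \<open>g\<close>.\<close>

definition L :: "'a \<Rightarrow> real" where
  "L x = \<bar>ln (exp (- T) * c)\<bar> + \<bar>ln (g x)\<bar>"

lemma measurable_g_L [measurable]: "g \<in> borel_measurable borel" "L \<in> borel_measurable borel"
  unfolding g_def[abs_def] L_def[abs_def] by measurable

lemma q_le_g: assumes "t \<in> {0..T}" shows "q t x \<le> g x"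
proof -
  have "q t x \<le> exp T * q T x"
    unfolding q_def using assms by (intro poisson_mix_le w_Suc_summable w_nonneg) auto
  also have "\<dots> \<le> (T + 1) * (exp T * q T x)"
    using T q_nonneg[of T x] mult_right_mono[of 1 "T + 1" "exp T * q T x"] by simp
  finally show ?thesis
    using w_nonneg[of 0 x] by (simp add: g_def mult.assoc)
qed

lemma u_le_g: assumes "t \<in> {0..T}" shows "u t x \<le> g x"
proof -
  have "u t x \<le> w 0 x + t * q t x"
    unfolding u_def q_def using assms by (intro poisson_mix_split w_summable w_nonneg) auto
  also have "t * q t x \<le> (T + 1) * (exp T * q T x)"
    unfolding q_def using assms
    by (intro mult_mono poisson_mix_le poisson_mix_nonneg w_Suc_summable w_nonneg) auto
  finally show ?thesis
    by (simp add: g_def mult.assoc)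
qed

lemma g_pos: "0 < g x"
  using u_le_g[of 0 x] u_pos[of 0 x] T by simp

lemma g_nonneg: "0 \<le> g x"
  using g_pos[of x] by simp

lemma L_nonneg: "0 \<le> L x"
  by (simp add: L_def)

lemma u_ge_T: "t \<in> {0..T} \<Longrightarrow> exp (- T) * c \<le> u t x"
  using w_0(1) by (intro order_trans[OF mult_right_mono u_ge]) auto

lemma ln_u_le: assumes t: "t \<in> {0..T}" shows "\<bar>ln (u t x)\<bar> \<le> L x"
proof -
  have "ln (exp (- T) * c) \<le> ln (u t x)"
    using u_ge_T[OF t, of x] w_0(1) by (intro ln_mono) auto
  moreover have "ln (u t x) \<le> ln (g x)"
    using u_le_g[OF t, of x] u_pos[of t x] t by (intro ln_mono) auto
  ultimately show ?thesis
    by (simp add: L_def)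
qed

lemma integrable_g: "integrable \<pi> g"
  unfolding g_def[abs_def]
  using integrable_q[of T] T integral_1(1)[of "w 0"] by (simp add: nn_integral_w w_nonneg)

lemma integrable_Phi_g: "integrable \<pi> (\<lambda>x. \<Phi> (g x))"
  unfolding g_def
  using T integrable_q[of T] q_nonneg[of T] integral_1(1)[of "w 0"] integrable_Phi_w0 integrable_Phi_q
  by (intro integrable_Phi_add integrable_Phi_mult) (auto simp: nn_integral_w w_nonneg)

lemma integrable_g_L: "integrable \<pi> (\<lambda>x. g x * L x)"
proof -
  have "integrable \<pi> (\<lambda>x. \<bar>ln (exp (- T) * c)\<bar> * g x + \<bar>\<Phi> (g x)\<bar>)"
    using integrable_g integrable_Phi_g by simp
  also have "(\<lambda>x. \<bar>ln (exp (- T) * c)\<bar> * g x + \<bar>\<Phi> (g x)\<bar>) = (\<lambda>x. g x * L x)"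
    using g_nonneg by (auto simp: L_def \<Phi>_def abs_mult algebra_simps)
  finally show ?thesis .
qed

context
  fixes t assumes t: "t \<in> {0..T}"
begin

lemma integrable_q_ln_u: "integrable \<pi> (\<lambda>x. q t x * ln (u t x))"
  by (rule integrable_norm_bound[OF integrable_g_L])
    (use t q_nonneg[of t] q_le_g[OF t] ln_u_le[OF t] g_nonneg in \<open>auto simp: abs_mult intro!: mult_mono\<close>)

lemma integrable_Phi_u: "integrable \<pi> (\<lambda>x. \<Phi> (u t x))"
  unfolding \<Phi>_def
  by (rule integrable_norm_bound[OF integrable_g_L])
    (use t u_nonneg[of t] u_le_g[OF t] ln_u_le[OF t] g_nonneg in \<open>auto simp: abs_mult intro!: mult_mono\<close>)

end

definition H :: "real \<Rightarrow> real" where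
  "H t = (\<integral>x. \<Phi> (u t x) \<partial>\<pi>)"

text \<open>By duality, the integral of \<open>u t\<close> times the posterior kernel applied to
  \<open>ln (u t)\<close>; see \<open>kernel_diff_u\<close>.\<close>

definition J :: "real \<Rightarrow> real" where
  "J t = (\<integral>x. q t x * ln (u t x) \<partial>\<pi>)"

lemma measurable_J [measurable]: "J \<in> borel_measurable borel"
  unfolding J_def[abs_def] by measurable

lemma measurable_H [measurable]: "H \<in> borel_measurable borel"
  unfolding H_def[abs_def] by measurable

lemma J_bound: "t \<in> {0..T} \<Longrightarrow> \<bar>J t\<bar> \<le> (\<integral>x. g x * L x \<partial>\<pi>)"
  unfolding J_def
  by (rule order_trans[OF integral_norm_bound[where 'a = real, unfolded real_norm_def]])
    (intro integral_mono integrable_abs integrable_q_ln_u integrable_g_L,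
      auto simp: abs_mult q_nonneg q_le_g ln_u_le g_nonneg intro!: mult_mono)

text \<open>This is \<open>H' = J - H\<close>, integrated against \<open>exp (\<gamma> t)\<close>.\<close>

lemma entropy_identity:
  "exp (\<gamma> * T) * H T - H 0
    = (LBINT t:{0..T}. exp (\<gamma> * t) * (\<gamma> * H t + J t - H t))"
proof -
  \<comment> \<open>Restricted Lebesgue measure is finite, so the bound \<open>B\<close>, which does
    not depend on \<open>t\<close>, is integrable over the product space.\<close>
  define \<Lambda> where "\<Lambda> = restrict_space lborel {0..T}"
  have sp: "space \<Lambda> = {0..T}"
    by (simp add: \<Lambda>_def space_restrict_space)
  have [measurable]: "(\<lambda>t. t) \<in> borel_measurable \<Lambda>"
    unfolding \<Lambda>_def by (intro measurable_restrict_space1) simp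
  interpret \<Lambda>: finite_measure \<Lambda>
    by (rule finite_measureI) (use T in \<open>simp add: \<Lambda>_def emeasure_restrict_space space_restrict_space\<close>)
  interpret pair_sigma_finite \<Lambda> \<pi> ..
  \<comment> \<open>The time derivative of \<open>exp (\<gamma> * t) * \<Phi> (u t x)\<close>, as
    \<open>\<Phi>\<close> has the derivative \<open>ln + 1\<close> and \<open>u\<close> the
    derivative \<open>q - u\<close>.\<close>
  define F where "F t x = exp (\<gamma> * t) * (\<gamma> * \<Phi> (u t x) + (ln (u t x) + 1) * (q t x - u t x))" for t x
  define B where "B x = exp (\<bar>\<gamma>\<bar> * T) * (\<bar>\<gamma>\<bar> * (g x * L x) + (L x + 1) * g x)" for x
  have [measurable]: "B \<in> borel_measurable borel"
    unfolding B_def[abs_def] by measurable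
  have Fm[measurable]: "(\<lambda>(t, x). F t x) \<in> borel_measurable (\<Lambda> \<Otimes>\<^sub>M \<pi>)"
    unfolding F_def by measurable
  have F_le: "\<bar>F t x\<bar> \<le> B x" if t: "t \<in> {0..T}" for t x
  proof -
    have "\<gamma> * t \<le> \<bar>\<gamma>\<bar> * T"
      using t by (intro mult_mono) auto
    moreover have "\<bar>\<Phi> (u t x)\<bar> \<le> g x * L x"
      using t u_nonneg[of t x] u_le_g[OF t, of x] ln_u_le[OF t, of x] g_nonneg[of x]
      by (auto simp: \<Phi>_def abs_mult intro!: mult_mono)
    moreover have "\<bar>ln (u t x) + 1\<bar> \<le> L x + 1"
      using ln_u_le[OF t, of x] by simp
    moreover have "\<bar>q t x - u t x\<bar> \<le> g x"
      using t u_nonneg[of t x] u_le_g[OF t, of x] q_nonneg[of t x] q_le_g[OF t, of x] by auto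
    ultimately show ?thesis
      unfolding F_def B_def abs_mult
      by (intro mult_mono order_trans[OF abs_triangle_ineq] add_mono)
        (auto simp: abs_mult intro!: mult_mono mult_left_mono)
  qed
  have intB: "integrable \<pi> B"
    unfolding B_def[abs_def] using integrable_g integrable_g_L by (simp add: ring_distribs mult.commute)
  have B_nonneg: "0 \<le> B x" for x
    using F_le[of 0 x] T by simp
  have "integrable (\<Lambda> \<Otimes>\<^sub>M \<pi>) (\<lambda>(t, x). B x)"
    using intB by (intro Fubini_integrable) auto
  then have intF: "integrable (\<Lambda> \<Otimes>\<^sub>M \<pi>) (\<lambda>(t, x). F t x)"
    by (rule integrable_norm_bound[OF _ Fm]) (auto simp: space_pair_measure sp intro!: F_le)
  have FTC: "(\<integral>t. F t x \<partial>\<Lambda>) = exp (\<gamma> * T) * \<Phi> (u T x) - \<Phi> (u 0 x)" for x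
  proof -
    have deriv: "((\<lambda>t. exp (\<gamma> * t) * \<Phi> (u t x)) has_real_derivative F t x) (at t within {0..T})"
      if "0 \<le> t" "t \<le> T" for t
      unfolding \<Phi>_def F_def using that u_pos[of t x]
      by (auto intro!: derivative_eq_intros DERIV_subset[OF u_deriv] simp: field_simps)
    have cont_u: "continuous_on {0..T} (\<lambda>t. u t x)"
      using u_deriv by (intro continuous_at_imp_continuous_on) (auto intro: DERIV_isCont)
    have "continuous_on {0..T} (\<lambda>t. q t x)"
      unfolding q_def
      by (intro continuous_at_imp_continuous_on ballI DERIV_isCont[OF poisson_mix_deriv] w_Suc_summable w_nonneg)
    then have "continuous_on {0..T} (\<lambda>t. F t x)"
      unfolding F_def \<Phi>_def using u_pos[of _ x]
      by (intro continuous_intros cont_u) (auto simp: less_imp_neq[symmetric])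
    then have "(LBINT t:{0..T}. F t x) = exp (\<gamma> * T) * \<Phi> (u T x) - exp (\<gamma> * 0) * \<Phi> (u 0 x)"
      unfolding set_lebesgue_integral_def using T deriv
      by (intro integral_FTC_atLeastAtMost) (auto simp: has_real_derivative_iff_has_vector_derivative)
    then show ?thesis
      by (simp add: \<Lambda>_def integral_restrict_space set_lebesgue_integral_def)
  qed
  \<comment> \<open>The summand 1 in the derivative of \<open>\<Phi>\<close> drops out, because
    \<open>q t\<close> and \<open>u t\<close> both have integral 1.\<close>
  have inner: "(\<integral>x. F t x \<partial>\<pi>) = exp (\<gamma> * t) * (\<gamma> * H t + J t - H t)" if t: "t \<in> {0..T}" for t
  proof -
    have "F t x = exp (\<gamma> * t) * (\<gamma> * \<Phi> (u t x) + q t x * ln (u t x) - \<Phi> (u t x) + q t x - u t x)" for x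
      by (simp add: F_def \<Phi>_def algebra_simps)
    then show ?thesis
      using t integrable_Phi_u[OF t] integrable_q_ln_u[OF t] integrable_u[of t] integrable_q[of t]
      by (simp add: H_def J_def integral_u integral_q)
  qed
  have "exp (\<gamma> * T) * H T - H 0 = (\<integral>x. \<integral>t. F t x \<partial>\<Lambda> \<partial>\<pi>)"
    unfolding FTC H_def using T integrable_Phi_u[of T] integrable_Phi_u[of 0] by simp
  also have "\<dots> = (\<integral>t. \<integral>x. F t x \<partial>\<pi> \<partial>\<Lambda>)"
    by (rule Fubini_integral[OF intF])
  also have "\<dots> = (\<integral>t. exp (\<gamma> * t) * (\<gamma> * H t + J t - H t) \<partial>\<Lambda>)"
    by (intro Bochner_Integration.integral_cong refl inner) (simp add: sp)
  finally show ?thesis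
    by (simp add: \<Lambda>_def integral_restrict_space set_lebesgue_integral_def)
qed

end

section \<open>The Dirichlet form of the prior and the kernel difference\<close>

lemma markov_kernelD:
  assumes "markov_kernel K"
  shows "K \<in> borel \<rightarrow>\<^sub>M prob_algebra borel" "K \<in> borel \<rightarrow>\<^sub>M subprob_algebra borel"
    and "prob_space (K x)" "sets (K x) = sets borel"
proof -
  show K: "K \<in> borel \<rightarrow>\<^sub>M prob_algebra borel"
    using assms by (simp add: markov_kernel_def)
  then show "K \<in> borel \<rightarrow>\<^sub>M subprob_algebra borel"
    by (rule measurable_prob_algebraD)
  show "prob_space (K x)" "sets (K x) = sets borel"
    using measurable_space[OF K, of x] by (simp_all add: space_prob_algebra)
qed

text \<open>The inner integrals see \<open>f\<close> under the kernels, which might charge a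
  \<open>\<pi>\<close>-null set. So agreement is also required almost everywhere for the images of
  \<open>\<pi>\<close> under both kernels.\<close>

lemma kernel_diff_cong_AE:
  assumes [measurable_cong]: "sets \<pi> = sets borel" and P: "markov_kernel P" and Q: "markov_kernel Q"
    and [measurable]: "f \<in> borel_measurable borel" "h \<in> borel_measurable borel"
    and eq: "AE x in \<pi>. f x = h x" "AE x in \<pi> \<bind> P. f x = h x" "AE x in \<pi> \<bind> Q. f x = h x"
  shows "kernel_diff \<pi> P Q f = kernel_diff \<pi> P Q h"
proof -
  note [measurable] = markov_kernelD(2)[OF P] markov_kernelD(2)[OF Q]
  note [measurable_cong] = markov_kernelD(4)[OF P] markov_kernelD(4)[OF Q]
  have m: "(\<lambda>x. \<integral>y. ln (f' y) \<partial>K x) \<in> borel_measurable \<pi>"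
    if "K \<in> borel \<rightarrow>\<^sub>M subprob_algebra borel" "f' \<in> borel_measurable borel" for K and f' :: "'a \<Rightarrow> real"
  proof -
    note [measurable] = that
    show ?thesis
      by (rule borel_measurable_kernel_integral[where N = borel]) measurable
  qed
  have P': "AE x in \<pi>. AE y in P x. f y = h y"
    using eq(2) by (subst (asm) AE_bind[where B = borel]) measurable
  have Q': "AE x in \<pi>. AE y in Q x. f y = h y"
    using eq(3) by (subst (asm) AE_bind[where B = borel]) measurable
  have "AE x in \<pi>. f x * ((\<integral>y. ln (f y) \<partial>Q x) - (\<integral>y. ln (f y) \<partial>P x))
      = h x * ((\<integral>y. ln (h y) \<partial>Q x) - (\<integral>y. ln (h y) \<partial>P x))"
    using eq(1) P' Q'
  proof eventually_elim
    case (elim x)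
    have "(\<integral>y. ln (f y) \<partial>Q x) = (\<integral>y. ln (h y) \<partial>Q x)"
      using elim(3) by (intro integral_cong_AE) auto
    moreover have "(\<integral>y. ln (f y) \<partial>P x) = (\<integral>y. ln (h y) \<partial>P x)"
      using elim(2) by (intro integral_cong_AE) auto
    ultimately show ?case
      using elim(1) by simp
  qed
  then show ?thesis
    unfolding kernel_diff_def
    by (intro integral_cong_AE borel_measurable_times borel_measurable_diff m markov_kernelD(2)[OF P] markov_kernelD(2)[OF Q]) auto
qed

locale jump_densities_prior = jump_densities_horizon +
  fixes P :: "'a \<Rightarrow> 'a measure"
  assumes P: "markov_kernel P" and invariant: "\<pi> \<bind> P = \<pi>"
begin

lemma measurable_P [measurable]: "P \<in> borel \<rightarrow>\<^sub>M subprob_algebra borel"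
  using P by (rule markov_kernelD)

lemma sets_P [measurable_cong]: "sets (P x) = sets borel"
  using P by (rule markov_kernelD)

lemma P_measurable_pi: "P \<in> \<pi> \<rightarrow>\<^sub>M subprob_algebra borel"
  by measurable

lemma emeasure_P: "emeasure (P x) (space (P x)) = 1"
  using prob_space.emeasure_space_1[OF markov_kernelD(3)[OF P]] .

lemma gL_measurable: "(\<lambda>(x, y). g x * L y) \<in> borel_measurable (\<pi> \<Otimes>\<^sub>M borel)"
  by measurable

text \<open>The mixed term is controlled by \<open>a * ln b \<le> \<Phi> a + b - a\<close> and the invariance of \<open>\<pi>\<close>.\<close>

lemma nn_integral_gL: "(\<integral>\<^sup>+x. \<integral>\<^sup>+y. ennreal \<bar>g x * L y\<bar> \<partial>P x \<partial>\<pi>) < \<infinity>"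
proof -
  define K where "K = \<bar>ln (exp (- T) * c)\<bar>"
  have bound: "\<bar>g x * L y\<bar> \<le> (\<bar>\<Phi> (g x)\<bar> + 3 * K * g x) + g y" for x y
  proof -
    have "exp (- T) * c \<le> g y"
      using u_ge_T[of 0 y] u_le_g[of 0 y] T by simp
    then have "ln (exp (- T) * c) \<le> ln (g y)"
      using w_0(1) by (intro ln_mono) auto
    \<comment> \<open>\<open>ln (g y) \<ge> - K\<close> gives
      \<open>\<bar>ln (g y)\<bar> \<le> ln (g y) + 2 * K\<close>; the third \<open>K\<close> is the
      first summand of \<open>L\<close>.\<close>
    then have "L y \<le> ln (g y) + 3 * K"
      by (simp add: L_def K_def)
    then have "g x * L y \<le> g x * (ln (g y) + 3 * K)"
      by (intro mult_left_mono g_nonneg)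
    also have "\<dots> \<le> (\<bar>\<Phi> (g x)\<bar> + 3 * K * g x) + g y"
      using mult_ln_le[OF g_nonneg g_pos, of x y] g_nonneg[of x] by (simp add: algebra_simps)
    finally show ?thesis
      using g_nonneg[of x] L_nonneg[of y] by simp
  qed
  have "(\<integral>\<^sup>+x. \<integral>\<^sup>+y. ennreal \<bar>g x * L y\<bar> \<partial>P x \<partial>\<pi>)
      \<le> (\<integral>\<^sup>+x. \<integral>\<^sup>+y. ennreal (\<bar>\<Phi> (g x)\<bar> + 3 * K * g x) + ennreal (g y) \<partial>P x \<partial>\<pi>)"
    using bound g_nonneg
    by (intro nn_integral_mono) (auto simp: K_def simp flip: ennreal_plus intro!: ennreal_leI)
  also have "\<dots> = (\<integral>\<^sup>+x. ennreal (\<bar>\<Phi> (g x)\<bar> + 3 * K * g x) + (\<integral>\<^sup>+y. ennreal (g y) \<partial>P x) \<partial>\<pi>)"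
    by (simp add: nn_integral_add emeasure_P)
  also have "\<dots> = (\<integral>\<^sup>+x. ennreal (\<bar>\<Phi> (g x)\<bar> + 3 * K * g x) \<partial>\<pi>) + (\<integral>\<^sup>+y. ennreal (g y) \<partial>(\<pi> \<bind> P))"
    by (subst nn_integral_add) (auto simp: nn_integral_bind[where B = borel])
  also have "\<dots> = (\<integral>\<^sup>+x. ennreal (\<bar>\<Phi> (g x)\<bar> + 3 * K * g x) \<partial>\<pi>) + (\<integral>\<^sup>+y. ennreal (g y) \<partial>\<pi>)"
    by (simp add: invariant)
  also have "\<dots> < \<infinity>"
    using integrable_Phi_g integrable_g g_nonneg
    by (subst (1 2) nn_integral_eq_integral) (auto simp: K_def intro!: add_nonneg_nonneg)
  finally show ?thesis .
qed

lemma AE_integrable_L: "AE x in \<pi>. integrable (P x) L"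
  using kernel_integral_AE[OF gL_measurable P_measurable_pi nn_integral_gL]
  by eventually_elim (use g_pos in \<open>auto simp: less_imp_neq[symmetric]\<close>)

lemma integrable_PL: "integrable \<pi> (\<lambda>x. g x * (\<integral>y. L y \<partial>P x))"
  using integrable_kernel_integral[OF gL_measurable P_measurable_pi nn_integral_gL] by simp

text \<open>The term common to both sides: the Dirichlet form is \<open>H - R\<close> and the kernel
  difference is \<open>J - R\<close>, so the entropy derivative \<open>J - H\<close> is the second
  minus the first.\<close>

definition R :: "real \<Rightarrow> real" where
  "R t = (\<integral>x. u t x * (\<integral>y. ln (u t y) \<partial>P x) \<partial>\<pi>)"

lemma measurable_R [measurable]: "R \<in> borel_measurable borel"
proof -
  have [measurable]: "(\<lambda>p. \<integral>y. ln (u (fst p) y) \<partial>P (snd p)) \<in> borel_measurable (borel \<Otimes>\<^sub>M borel)"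
    by (rule borel_measurable_kernel_integral[where N = borel]) measurable
  show ?thesis
    unfolding R_def[abs_def] by measurable
qed

context
  fixes t assumes t: "t \<in> {0..T}"
begin

lemma AE_integrable_ln_u: "AE x in \<pi>. integrable (P x) (\<lambda>y. ln (u t y))"
  using AE_integrable_L
  by eventually_elim (erule integrable_norm_bound, use ln_u_le[OF t] in auto)

lemma measurable_P_ln_u: "(\<lambda>x. \<integral>y. ln (u t y) \<partial>P x) \<in> borel_measurable borel"
  by (rule borel_measurable_kernel_integral[where N = borel]) measurable

lemma R_integrand_le:
  "AE x in \<pi>. \<bar>u t x * (\<integral>y. ln (u t y) \<partial>P x)\<bar> \<le> g x * (\<integral>y. L y \<partial>P x)"
  using AE_integrable_L AE_integrable_ln_u
proof eventually_elim
  case (elim x)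
  have "\<bar>\<integral>y. ln (u t y) \<partial>P x\<bar> \<le> (\<integral>y. \<bar>ln (u t y)\<bar> \<partial>P x)"
    using integral_norm_bound[of "P x" "\<lambda>y. ln (u t y)"] by simp
  also have "\<dots> \<le> (\<integral>y. L y \<partial>P x)"
    using elim ln_u_le[OF t] by (intro integral_mono) auto
  finally show ?case
    using t u_nonneg[of t x] u_le_g[OF t, of x] g_nonneg[of x] by (auto simp: abs_mult intro!: mult_mono)
qed

lemma integrable_R: "integrable \<pi> (\<lambda>x. u t x * (\<integral>y. ln (u t y) \<partial>P x))"
proof (rule Bochner_Integration.integrable_bound[OF integrable_PL])
  show "(\<lambda>x. u t x * (\<integral>y. ln (u t y) \<partial>P x)) \<in> borel_measurable \<pi>"
    using measurable_P_ln_u by measurable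
  show "AE x in \<pi>. norm (u t x * (\<integral>y. ln (u t y) \<partial>P x)) \<le> norm (g x * (\<integral>y. L y \<partial>P x))"
    using R_integrand_le by eventually_elim simp
qed

lemma R_bound: "\<bar>R t\<bar> \<le> (\<integral>x. g x * (\<integral>y. L y \<partial>P x) \<partial>\<pi>)"
proof -
  have "\<bar>R t\<bar> \<le> (\<integral>x. \<bar>u t x * (\<integral>y. ln (u t y) \<partial>P x)\<bar> \<partial>\<pi>)"
    unfolding R_def using integral_norm_bound[of \<pi> "\<lambda>x. u t x * (\<integral>y. ln (u t y) \<partial>P x)"] by simp
  also have "\<dots> \<le> (\<integral>x. g x * (\<integral>y. L y \<partial>P x) \<partial>\<pi>)"
    by (intro integral_mono_AE integrable_abs integrable_R integrable_PL R_integrand_le)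
  finally show ?thesis .
qed

text \<open>The integrand is dominated by \<open>g x * L x + g x * L y\<close>, so both parts of the
  extended-valued form are finite and the two logarithms may be integrated separately.\<close>

lemma log_dirichlet_u: "log_dirichlet \<pi> P (u t) = ereal (H t - R t)"
proof -
  let ?F = "\<lambda>x y. u t x * (ln (u t x) - ln (u t y))"
  have F: "(\<lambda>(x, y). ?F x y) \<in> borel_measurable (\<pi> \<Otimes>\<^sub>M borel)"
    by measurable
  have "\<bar>?F x y\<bar> \<le> g x * L x + \<bar>g x * L y\<bar>" for x y
  proof -
    have "\<bar>ln (u t x) - ln (u t y)\<bar> \<le> L x + L y"
      using ln_u_le[OF t, of x] ln_u_le[OF t, of y] by simp
    then have "\<bar>?F x y\<bar> \<le> g x * (L x + L y)"
      using t u_nonneg[of t x] u_le_g[OF t, of x] g_nonneg[of x] by (auto simp: abs_mult intro!: mult_mono)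
    then show ?thesis
      using g_nonneg[of x] L_nonneg[of y] by (simp add: algebra_simps)
  qed
  then have "(\<integral>\<^sup>+x. \<integral>\<^sup>+y. ennreal \<bar>?F x y\<bar> \<partial>P x \<partial>\<pi>)
      \<le> (\<integral>\<^sup>+x. \<integral>\<^sup>+y. ennreal (g x * L x) + ennreal \<bar>g x * L y\<bar> \<partial>P x \<partial>\<pi>)"
    using g_nonneg L_nonneg by (intro nn_integral_mono) (auto simp flip: ennreal_plus intro!: ennreal_leI)
  also have "\<dots> = (\<integral>\<^sup>+x. ennreal (g x * L x) \<partial>\<pi>) + (\<integral>\<^sup>+x. \<integral>\<^sup>+y. ennreal \<bar>g x * L y\<bar> \<partial>P x \<partial>\<pi>)"
    by (subst nn_integral_add[symmetric])
      (auto simp: nn_integral_add emeasure_P intro!: nn_integral_measurable_subprob_algebra2[where N = borel])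
  also have "\<dots> < \<infinity>"
    using nn_integral_gL g_nonneg L_nonneg by (subst nn_integral_eq_integral[OF integrable_g_L]) auto
  finally have fin: "(\<integral>\<^sup>+x. \<integral>\<^sup>+y. ennreal \<bar>?F x y\<bar> \<partial>P x \<partial>\<pi>) < \<infinity>" .
  have "log_dirichlet \<pi> P (u t) = ereal (\<integral>x. \<integral>y. ?F x y \<partial>P x \<partial>\<pi>)"
    unfolding log_dirichlet_def by (rule kernel_integral_eq[OF F P_measurable_pi fin, symmetric])
  also have "(\<integral>x. \<integral>y. ?F x y \<partial>P x \<partial>\<pi>) = (\<integral>x. \<Phi> (u t x) - u t x * (\<integral>y. ln (u t y) \<partial>P x) \<partial>\<pi>)"
  proof (rule integral_cong_AE)
    show "(\<lambda>x. \<integral>y. ?F x y \<partial>P x) \<in> borel_measurable \<pi>"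
      by (rule borel_measurable_kernel_integral[OF F P_measurable_pi])
    show "(\<lambda>x. \<Phi> (u t x) - u t x * (\<integral>y. ln (u t y) \<partial>P x)) \<in> borel_measurable \<pi>"
      using measurable_P_ln_u by measurable
    show "AE x in \<pi>. (\<integral>y. ?F x y \<partial>P x) = \<Phi> (u t x) - u t x * (\<integral>y. ln (u t y) \<partial>P x)"
      using AE_integrable_ln_u
    proof eventually_elim
      case (elim x)
      interpret Px: prob_space "P x"
        using P by (rule markov_kernelD)
      show ?case
        using elim by (simp add: \<Phi>_def right_diff_distrib Px.prob_space)
    qed
  qed
  also have "\<dots> = H t - R t"
    unfolding H_def R_def by (intro Bochner_Integration.integral_diff integrable_Phi_u integrable_R t)
  finally show ?thesis .
qed

lemma modified_LSI_u:
  assumes "modified_LSI \<pi> P \<gamma>"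
  shows "\<gamma> * H t \<le> H t - R t"
proof -
  \<comment> \<open>The second term of \<open>Ent\<close> is \<open>\<Phi> 1 = 0\<close>.\<close>
  have "Ent \<pi> (u t) = H t"
    using t by (simp add: Ent_def H_def integral_u) (simp add: \<Phi>_def)
  moreover have "ereal (\<gamma> * Ent \<pi> (u t)) \<le> log_dirichlet \<pi> P (u t)"
    using assms t integrable_Phi_u[OF t] u_pos[of t]
    by (auto simp: modified_LSI_def \<Phi>_def)
  ultimately show ?thesis
    by (simp add: log_dirichlet_u)
qed

text \<open>Duality: \<open>ln (u t)\<close> is integrated against
  \<open>density \<pi> (u t) \<bind> Q\<close> in two ways, through the kernel and through the
  density \<open>q t\<close>. The difference may be split because both parts are integrable.\<close>

lemma kernel_diff_u:
  assumes Q: "markov_kernel Q" and step: "density \<pi> (u t) \<bind> Q = density \<pi> (q t)"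
  shows "kernel_diff \<pi> P Q (u t) = J t - R t"
proof -
  note [measurable] = markov_kernelD(2)[OF Q]
  have nonneg: "AE x in \<pi>. 0 \<le> u t x" "AE x in \<pi>. 0 \<le> q t x"
    using t u_nonneg[of t] q_nonneg[of t] by auto
  have "integrable (density \<pi> (u t) \<bind> Q) (\<lambda>y. ln (u t y))"
    unfolding step using nonneg integrable_q_ln_u[OF t] by (subst integrable_density) auto
  note bind = integral_bind_integrable[where N = borel, OF _ _ _ this]
  have int: "integrable \<pi> (\<lambda>x. u t x * (\<integral>y. ln (u t y) \<partial>Q x))"
    and eq: "(\<integral>x. u t x * (\<integral>y. ln (u t y) \<partial>Q x) \<partial>\<pi>) = J t"
  proof -
    have m: "(\<lambda>x. \<integral>y. ln (u t y) \<partial>Q x) \<in> borel_measurable \<pi>"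
      by (rule borel_measurable_kernel_integral[where N = borel]) measurable
    have "integrable (density \<pi> (u t)) (\<lambda>x. \<integral>y. ln (u t y) \<partial>Q x)"
      by (rule bind(2)) (auto simp: not_empty)
    then show "integrable \<pi> (\<lambda>x. u t x * (\<integral>y. ln (u t y) \<partial>Q x))"
      using nonneg m by (subst (asm) integrable_density) auto
    have "(\<integral>x. u t x * (\<integral>y. ln (u t y) \<partial>Q x) \<partial>\<pi>) = (\<integral>x. \<integral>y. ln (u t y) \<partial>Q x \<partial>density \<pi> (u t))"
      using nonneg m by (subst integral_density) auto
    also have "\<dots> = (\<integral>y. ln (u t y) \<partial>density \<pi> (q t))"
      unfolding step[symmetric] by (rule bind(3)) (auto simp: not_empty)
    also have "\<dots> = J t"
      unfolding J_def using nonneg by (subst integral_density) auto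
    finally show "(\<integral>x. u t x * (\<integral>y. ln (u t y) \<partial>Q x) \<partial>\<pi>) = J t" .
  qed
  show ?thesis
    unfolding kernel_diff_def right_diff_distrib
    using int integrable_R by (simp add: eq R_def)
qed

end

text \<open>Gronwall's argument in integrated form: the weight \<open>exp (\<gamma> * t)\<close> in
  \<open>entropy_identity\<close> is the integrating factor, and the LSI bounds
  \<open>\<gamma> * H t + J t - H t\<close> by \<open>J t - R t\<close>, which removes
  \<open>H\<close> from the integrand.\<close>

lemma entropy_bound:
  assumes LSI: "modified_LSI \<pi> P \<gamma>"
  shows "H T \<le> (LBINT t:{0..T}. exp (- \<gamma> * (T - t)) * (J t - R t)) + exp (- \<gamma> * T) * H 0"
proof -
  \<comment> \<open>Monotonicity of the Bochner integral needs integrability on both sides, here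
    from bounds on the compact interval.\<close>
  have bounded: "set_integrable lborel {0..T} f"
    if [measurable]: "f \<in> borel_measurable borel" and "\<And>t. t \<in> {0..T} \<Longrightarrow> \<bar>f t\<bar> \<le> K" for f :: "real \<Rightarrow> real" and K
  proof -
    have "integrable lborel (\<lambda>t. K * indicator {0..T} t)"
      by (intro integrable_mult_right integrable_real_indicator) (simp_all add: emeasure_lborel_Icc_eq)
    then show ?thesis
      unfolding set_integrable_def
      by (rule integrable_norm_bound) (use that(2) in \<open>auto simp: indicator_def\<close>)
  qed
  \<comment> \<open>\<open>\<gamma>\<close> may have either sign, whence the absolute value.\<close>
  have exp_le: "exp (\<gamma> * t) \<le> exp (\<bar>\<gamma>\<bar> * T)" if "t \<in> {0..T}" for t
    using that by (auto intro!: mult_mono)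
  define CJ where "CJ = (\<integral>x. g x * L x \<partial>\<pi>)"
  define CR where "CR = (\<integral>x. g x * (\<integral>y. L y \<partial>P x) \<partial>\<pi>)"
  have "\<bar>exp (\<gamma> * t) * (J t - R t)\<bar> \<le> exp (\<bar>\<gamma>\<bar> * T) * (CJ + CR)" if "t \<in> {0..T}" for t
    using J_bound[OF that] R_bound[OF that] exp_le[OF that]
    unfolding CJ_def[symmetric] CR_def[symmetric] abs_mult by (intro mult_mono) auto
  then have int2: "set_integrable lborel {0..T} (\<lambda>t. exp (\<gamma> * t) * (J t - R t))"
    by (rule bounded[rotated]) measurable
  have H_le: "\<bar>H t\<bar> \<le> CJ" if "t \<in> {0..T}" for t
  proof -
    have "\<bar>H t\<bar> \<le> (\<integral>x. \<bar>\<Phi> (u t x)\<bar> \<partial>\<pi>)"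
      unfolding H_def using integral_norm_bound[of \<pi> "\<lambda>x. \<Phi> (u t x)"] by simp
    also have "\<dots> \<le> CJ"
      unfolding CJ_def
      using that u_nonneg[of t] u_le_g[OF that] ln_u_le[OF that] g_nonneg
      by (intro integral_mono integrable_abs integrable_Phi_u integrable_g_L)
        (auto simp: \<Phi>_def abs_mult intro!: mult_mono)
    finally show ?thesis .
  qed
  have "\<bar>exp (\<gamma> * t) * (\<gamma> * H t + J t - H t)\<bar> \<le> exp (\<bar>\<gamma>\<bar> * T) * (\<bar>\<gamma>\<bar> * CJ + CJ + CJ)" if "t \<in> {0..T}" for t
  proof -
    have "\<bar>\<gamma> * H t\<bar> \<le> \<bar>\<gamma>\<bar> * CJ"
      using H_le[OF that] by (simp add: abs_mult mult_left_mono)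
    then have "\<bar>\<gamma> * H t + J t - H t\<bar> \<le> \<bar>\<gamma>\<bar> * CJ + CJ + CJ"
      using J_bound[OF that, folded CJ_def] H_le[OF that] by linarith
    then show ?thesis
      using exp_le[OF that] unfolding abs_mult by (intro mult_mono) auto
  qed
  then have int1: "set_integrable lborel {0..T} (\<lambda>t. exp (\<gamma> * t) * (\<gamma> * H t + J t - H t))"
    by (rule bounded[rotated]) measurable
  have "exp (\<gamma> * T) * H T - H 0 \<le> (LBINT t:{0..T}. exp (\<gamma> * t) * (J t - R t))"
    unfolding entropy_identity
  proof (rule set_integral_mono[OF int1 int2])
    fix t assume "t \<in> {0..T}"
    from modified_LSI_u[OF this LSI] show "exp (\<gamma> * t) * (\<gamma> * H t + J t - H t) \<le> exp (\<gamma> * t) * (J t - R t)"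
      by (intro mult_left_mono) auto
  qed
  then have "exp (- \<gamma> * T) * (exp (\<gamma> * T) * H T - H 0)
      \<le> exp (- \<gamma> * T) * (LBINT t:{0..T}. exp (\<gamma> * t) * (J t - R t))"
    by (intro mult_left_mono) auto
  also have "\<dots> = (LBINT t:{0..T}. exp (- \<gamma> * T) * (exp (\<gamma> * t) * (J t - R t)))"
    by simp
  also have "\<dots> = (LBINT t:{0..T}. exp (- \<gamma> * (T - t)) * (J t - R t))"
  proof -
    have "exp (- \<gamma> * T) * exp (\<gamma> * t) = exp (- \<gamma> * (T - t))" for t
      by (simp add: mult_exp_exp right_diff_distrib)
    then show ?thesis
      by (simp only: mult.assoc[symmetric])
  qed
  finally show ?thesis
    by (simp add: right_diff_distrib mult_exp_exp mult.assoc[symmetric])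
qed

end

section \<open>Laws of the Poissonized chain\<close>

text \<open>The Markov property conditions on the whole history; taking expectations, by the tower
  property, leaves the one-step recursion of the laws.\<close>

lemma markov_chain_law_Suc:
  assumes "prob_space M" and K: "markov_kernel K" and X: "markov_chain M X \<mu>\<^sub>0 K"
  shows "distr M borel (X (Suc k)) = distr M borel (X k) \<bind> K"
proof (rule measure_eqI)
  interpret prob_space M by fact
  have Xm[measurable]: "X k \<in> borel_measurable M" for k
    using X by (simp add: markov_chain_def)
  note [measurable] = markov_kernelD(2)[OF K]
  have sub: "subalgebra M (history M X k)"
    unfolding subalgebra_def history_def
  proof
    have "(\<lambda>\<omega>. \<lambda>i\<in>{..k}. X i \<omega>) \<in> M \<rightarrow>\<^sub>M (\<Pi>\<^sub>M i\<in>{..k}. borel)"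
      by (intro measurable_restrict Xm)
    then show "sets (vimage_algebra (space M) (\<lambda>\<omega>. \<lambda>i\<in>{..k}. X i \<omega>) (\<Pi>\<^sub>M i\<in>{..k}. borel)) \<subseteq> sets M"
      by (rule sets_image_in_sets[OF refl])
  qed simp
  interpret finite_measure_subalgebra M "history M X k"
    by unfold_locales (rule sub)
  have sets: "sets (distr M borel (X k) \<bind> K) = sets borel"
    by (rule sets_bind) (auto simp: markov_kernelD[OF K])
  then show "sets (distr M borel (X (Suc k))) = sets (distr M borel (X k) \<bind> K)"
    by simp
  fix A assume "A \<in> sets (distr M borel (X (Suc k)))"
  then have A[measurable]: "A \<in> sets borel" by simp
  interpret K: prob_space "K x" for x
    using K by (rule markov_kernelD)
  have int: "integrable M (\<lambda>\<omega>. indicator A (X (Suc k) \<omega>) :: real)"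
    by (rule integrable_const_bound[of _ 1]) (auto simp: indicator_def)
  have "emeasure (distr M borel (X (Suc k))) A = (\<integral>\<^sup>+x. ennreal (indicator A x) \<partial>distr M borel (X (Suc k)))"
    by (simp add: ennreal_indicator)
  also have "\<dots> = (\<integral>\<^sup>+\<omega>. ennreal (indicator A (X (Suc k) \<omega>)) \<partial>M)"
    by (rule nn_integral_distr) measurable
  also have "\<dots> = ennreal (\<integral>\<omega>. indicator A (X (Suc k) \<omega>) \<partial>M)"
    using int by (intro nn_integral_eq_integral) auto
  also have "(\<integral>\<omega>. indicator A (X (Suc k) \<omega>) \<partial>M)
      = (\<integral>\<omega>. real_cond_exp M (history M X k) (\<lambda>\<omega>. indicator A (X (Suc k) \<omega>)) \<omega> \<partial>M)"
    using real_cond_exp_int(2)[OF int] by simp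
  also have "\<dots> = (\<integral>\<omega>. measure (K (X k \<omega>)) A \<partial>M)"
    using X A by (intro integral_cong_AE) (auto simp: markov_chain_def)
  also have "ennreal \<dots> = (\<integral>\<^sup>+\<omega>. ennreal (measure (K (X k \<omega>)) A) \<partial>M)"
    by (intro nn_integral_eq_integral[symmetric] integrable_const_bound[of _ 1]) (auto simp: K.prob_le_1)
  also have "\<dots> = (\<integral>\<^sup>+\<omega>. emeasure (K (X k \<omega>)) A \<partial>M)"
    by (simp add: K.emeasure_eq_measure)
  also have "\<dots> = emeasure (distr M borel (X k) \<bind> K) A"
    by (subst emeasure_bind[where N = borel]) (auto simp: nn_integral_distr)
  finally show "emeasure (distr M borel (X (Suc k))) A = emeasure (distr M borel (X k) \<bind> K) A" .
qed

text \<open>\<open>N t\<close> is almost surely the increment from 0. The definition speaks of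
  increments over \<open>s < t\<close> only; at \<open>t = 0\<close> the formula is the point mass
  at 0, with \<open>0 ^ 0 = 1\<close>.\<close>

lemma poisson_process_marginal:
  assumes "prob_space M" and N: "poisson_process M 1 N" and t: "0 \<le> t"
  shows "measure M {\<omega> \<in> space M. N t \<omega> = k} = exp (- t) * (t ^ k / fact k)"
proof -
  interpret prob_space M by fact
  have [measurable]: "N t \<in> M \<rightarrow>\<^sub>M count_space UNIV" if "0 \<le> t" for t
    using N that by (simp add: poisson_process_def)
  note m = this[OF t] this[of 0]
  have N0: "AE \<omega> in M. N 0 \<omega> = 0"
    using N by (auto simp: poisson_process_def)
  show ?thesis
  proof (cases "t = 0")
    case True
    have "measure M {\<omega> \<in> space M. N 0 \<omega> = k} = measure M {\<omega> \<in> space M. k = 0}"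
      using N0 m by (intro finite_measure_eq_AE) auto
    with True show ?thesis
      by (cases "k = 0") (auto simp: prob_space)
  next
    case False
    with t have "0 < t" by simp
    with N have d: "distr M (count_space UNIV) (\<lambda>\<omega>. N t \<omega> - N 0 \<omega>) = measure_pmf (poisson_pmf t)"
      by (auto simp: poisson_process_def)
    have "measure M {\<omega> \<in> space M. N t \<omega> = k} = measure M {\<omega> \<in> space M. N t \<omega> - N 0 \<omega> = k}"
      using N0 m by (intro finite_measure_eq_AE) auto
    also have "\<dots> = measure (distr M (count_space UNIV) (\<lambda>\<omega>. N t \<omega> - N 0 \<omega>)) {k}"
      using m by (subst measure_distr) (auto intro!: arg_cong[where f = "measure M"])
    also have "\<dots> = pmf (poisson_pmf t) k"
      by (simp add: d measure_pmf_single)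
    finally show ?thesis
      using \<open>0 < t\<close> by simp
  qed
qed

lemma measurable_poissonized:
  assumes [measurable]: "\<And>k. X k \<in> borel_measurable M" "N t \<in> M \<rightarrow>\<^sub>M count_space UNIV"
  shows "poissonized X N t \<in> borel_measurable M"
  unfolding poissonized_def[abs_def] by measurable

text \<open>The event is split by the value of \<open>N t\<close>, and independence factors each
  piece into a Poisson weight and a law of the jump chain.\<close>

lemma poissonized_law:
  assumes "prob_space M" and X[measurable]: "\<And>k. X k \<in> borel_measurable M"
    and N: "poisson_process M 1 N" and indep: "indep_processes M X N"
    and t: "0 \<le> t" and A[measurable]: "A \<in> sets borel"
  shows "emeasure (distr M borel (poissonized X N t)) A
    = (\<Sum>k. ennreal (exp (- t) * (t ^ k / fact k)) * emeasure (distr M borel (X k)) A)"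
proof -
  interpret prob_space M by fact
  have Nm[measurable]: "N t \<in> M \<rightarrow>\<^sub>M count_space UNIV"
    using N t by (simp add: poisson_process_def)
  let ?XA = "\<lambda>k. {\<omega> \<in> space M. X k \<omega> \<in> A}" and ?N = "\<lambda>k. {\<omega> \<in> space M. N t \<omega> = k}"
  \<comment> \<open>Independence is stated for the sigma-algebras generated by whole paths; both
    events are preimages of sets of paths that constrain a single coordinate.\<close>
  have prod: "measure M (?XA k \<inter> ?N k) = measure M (?XA k) * measure M (?N k)" for k
  proof (rule indep_setD[OF indep[unfolded indep_processes_def]])
    have "(\<lambda>\<omega> k. X k \<omega>) -` {f \<in> space (\<Pi>\<^sub>M k\<in>UNIV. borel). f k \<in> A} \<inter> space M
        \<in> sets (vimage_algebra (space M) (\<lambda>\<omega> k. X k \<omega>) (\<Pi>\<^sub>M k\<in>UNIV. borel))"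
      by (intro in_vimage_algebra) measurable
    then show "?XA k \<in> sets (vimage_algebra (space M) (\<lambda>\<omega> k. X k \<omega>) (\<Pi>\<^sub>M k\<in>UNIV. borel))"
      by (rule back_subst[where P = "\<lambda>B. B \<in> _"]) (auto simp: space_PiM)
    have "(\<lambda>\<omega>. \<lambda>t\<in>{0..}. N t \<omega>) -` {f \<in> space (\<Pi>\<^sub>M t\<in>{0..}. count_space UNIV). f t = k} \<inter> space M
        \<in> sets (vimage_algebra (space M) (\<lambda>\<omega>. \<lambda>t\<in>{0..}. N t \<omega>) (\<Pi>\<^sub>M t\<in>{0..}. count_space UNIV))"
      using t by (intro in_vimage_algebra) measurable
    then show "?N k \<in> sets (vimage_algebra (space M) (\<lambda>\<omega>. \<lambda>t\<in>{0..}. N t \<omega>) (\<Pi>\<^sub>M t\<in>{0..}. count_space UNIV))"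
      by (rule back_subst[where P = "\<lambda>B. B \<in> _"]) (use t in \<open>auto simp: space_PiM\<close>)
  qed
  have "emeasure (distr M borel (poissonized X N t)) A = emeasure M (\<Union>k. ?XA k \<inter> ?N k)"
    using measurable_poissonized[of X M N t, OF X Nm]
    by (subst emeasure_distr) (auto intro!: arg_cong[where f = "emeasure M"] simp: poissonized_def)
  also have "\<dots> = (\<Sum>k. emeasure M (?XA k \<inter> ?N k))"
    by (intro suminf_emeasure[symmetric]) (auto simp: disjoint_family_on_def)
  also have "\<dots> = (\<Sum>k. ennreal (exp (- t) * (t ^ k / fact k)) * emeasure (distr M borel (X k)) A)"
  proof (intro suminf_cong)
    fix k
    have "emeasure (distr M borel (X k)) A = emeasure M (?XA k)"
      by (subst emeasure_distr) (auto intro!: arg_cong[where f = "emeasure M"])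
    then show "emeasure M (?XA k \<inter> ?N k)
        = ennreal (exp (- t) * (t ^ k / fact k)) * emeasure (distr M borel (X k)) A"
      using t by (simp add: emeasure_eq_measure prod poisson_process_marginal[OF prob_space_axioms N t]
          mult.commute flip: ennreal_mult)
  qed
  finally show ?thesis .
qed

section \<open>Radon-Nikodym densities and relative entropy\<close>

lemma density_dens:
  assumes "prob_space \<pi>" "prob_space \<mu>" "absolutely_continuous \<pi> \<mu>" "sets \<mu> = sets \<pi>"
  shows "density \<pi> (\<lambda>x. ennreal (dens \<pi> \<mu> x)) = \<mu>"
proof -
  interpret \<pi>: prob_space \<pi> by fact
  interpret \<mu>: prob_space \<mu> by fact
  \<comment> \<open>\<open>enn2real\<close> in \<open>dens\<close> would turn an infinite derivative
    into 0; this happens only on a null set.\<close>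
  have "AE x in \<pi>. RN_deriv \<pi> \<mu> x \<noteq> \<infinity>"
    by (rule \<pi>.RN_deriv_finite) (use assms \<mu>.sigma_finite_measure_axioms in auto)
  then have "density \<pi> (\<lambda>x. ennreal (dens \<pi> \<mu> x)) = density \<pi> (RN_deriv \<pi> \<mu>)"
    unfolding dens_def by (intro density_cong) (auto simp: less_top)
  also have "\<dots> = \<mu>"
    using assms by (intro \<pi>.density_RN_deriv) auto
  finally show ?thesis .
qed

lemma dens_density:
  assumes "prob_space \<pi>" and f: "f \<in> borel_measurable \<pi>" "\<And>x. 0 \<le> f x"
    and eq: "density \<pi> (\<lambda>x. ennreal (f x)) = \<mu>"
  shows "AE x in \<pi>. dens \<pi> \<mu> x = f x"
proof -
  interpret prob_space \<pi> by fact
  have "AE x in \<pi>. ennreal (f x) = RN_deriv \<pi> \<mu> x"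
    using f eq by (intro RN_deriv_unique) auto
  then show ?thesis
    by eventually_elim (metis dens_def enn2real_ennreal f(2))
qed

lemma measurable_dens [measurable]: "dens \<pi> \<mu> \<in> borel_measurable \<pi>"
  unfolding dens_def[abs_def] by measurable

lemma nonneg_dens: "0 \<le> dens \<pi> \<mu> x"
  by (simp add: dens_def)

text \<open>Redefining the densities on a null set makes the Poisson mixtures converge everywhere.\<close>

lemma exists_summable_densities:
  fixes \<pi> :: "'a::topological_space measure"
  assumes \<pi>: "prob_space \<pi>" and sets[measurable_cong]: "sets \<pi> = sets borel"
    and \<mu>: "\<And>k. prob_space (\<mu> k)" "\<And>k. absolutely_continuous \<pi> (\<mu> k)" "\<And>k. sets (\<mu> k) = sets \<pi>"
    and c: "AE x in \<pi>. c \<le> dens \<pi> (\<mu> 0) x"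
  obtains w :: "nat \<Rightarrow> 'a \<Rightarrow> real" where "\<And>k. w k \<in> borel_measurable borel" "\<And>k x. 0 \<le> w k x"
    "\<And>x. c \<le> w 0 x" "\<And>t x. summable (\<lambda>k. t ^ k / fact k * w k x)"
    "\<And>k. density \<pi> (\<lambda>x. ennreal (w k x)) = \<mu> k"
proof -
  interpret prob_space \<pi> by fact
  define w' where "w' k = dens \<pi> (\<mu> k)" for k
  have [measurable]: "w' k \<in> borel_measurable borel" for k
    using measurable_dens[of \<pi> "\<mu> k"] unfolding w'_def by (simp cong: measurable_cong_sets add: sets)
  have dens_w': "density \<pi> (\<lambda>x. ennreal (w' k x)) = \<mu> k" for k
    unfolding w'_def by (intro density_dens \<pi> \<mu>)
  have one: "(\<integral>\<^sup>+x. ennreal (w' k x) \<partial>\<pi>) = 1" for k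
  proof -
    have "(\<integral>\<^sup>+x. ennreal (w' k x) \<partial>\<pi>) = emeasure (\<mu> k) (space \<pi>)"
      by (subst dens_w'[symmetric]) (simp add: emeasure_density)
    then show ?thesis
      using prob_space.emeasure_space_1[OF \<mu>(1)] sets_eq_imp_space_eq[OF \<mu>(3)] by simp
  qed
  \<comment> \<open>Natural times suffice, as \<open>\<bar>t\<bar> \<le> j\<close> gives convergence
    at \<open>t\<close> by comparison; so only countably many null sets have to be
    discarded.\<close>
  define S where "S j x = (\<Sum>k. ennreal (real j ^ k / fact k * w' k x))" for j x
  have [measurable]: "S j \<in> borel_measurable borel" for j
    unfolding S_def[abs_def] by measurable
  have S_fin: "AE x in \<pi>. S j x \<noteq> \<infinity>" for j
  proof (rule nn_integral_PInf_AE)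
    show "S j \<in> borel_measurable \<pi>" by measurable
    have "(\<integral>\<^sup>+x. S j x \<partial>\<pi>) = (\<Sum>k. \<integral>\<^sup>+x. ennreal (real j ^ k / fact k) * ennreal (w' k x) \<partial>\<pi>)"
      unfolding S_def
      by (subst nn_integral_suminf) (auto simp: w'_def nonneg_dens simp flip: ennreal_mult)
    also have "\<dots> = (\<Sum>k. ennreal (real j ^ k / fact k))"
      by (simp add: nn_integral_cmult one)
    also have "\<dots> = ennreal (\<Sum>k. real j ^ k / fact k)"
      using summable_exp_generic[of "real j"]
      by (intro suminf_ennreal2) (auto simp: field_simps scaleR_conv_of_real)
    finally show "(\<integral>\<^sup>+x. S j x \<partial>\<pi>) \<noteq> \<infinity>" by simp
  qed
  define good where "good x \<longleftrightarrow> c \<le> w' 0 x \<and> (\<forall>j. S j x \<noteq> \<infinity>)" for x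
  have [measurable]: "Measurable.pred borel good"
    unfolding good_def[abs_def] by measurable
  have good: "AE x in \<pi>. good x"
    unfolding good_def using c S_fin by (auto simp: AE_all_countable w'_def)
  \<comment> \<open>The constant \<open>max 1 c\<close> is nonnegative and at least
    \<open>c\<close>, and a constant sequence has a convergent Poisson series.\<close>
  define w where "w k x = (if good x then w' k x else max 1 c)" for k x
  show ?thesis
  proof
    show "w k \<in> borel_measurable borel" for k
      unfolding w_def[abs_def] by measurable
    show "0 \<le> w k x" for k x
      by (simp add: w_def w'_def nonneg_dens le_max_iff_disj)
    show "c \<le> w 0 x" for x
      by (simp add: w_def good_def)
    show "summable (\<lambda>k. t ^ k / fact k * w k x)" for t x
    proof (cases "good x")
      case True
      obtain j :: nat where j: "\<bar>t\<bar> \<le> real j"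
        using real_arch_simple by blast
      have "S j x \<noteq> \<infinity>"
        using True by (simp add: good_def)
      then have "summable (\<lambda>k. real j ^ k / fact k * w' k x)"
        unfolding S_def by (intro summable_suminf_not_top) (auto simp: w'_def nonneg_dens)
      then show ?thesis
      proof (rule summable_comparison_test')
        fix k
        have "\<bar>t\<bar> ^ k / fact k * w' k x \<le> real j ^ k / fact k * w' k x"
          using j by (intro mult_right_mono divide_right_mono power_mono) (auto simp: w'_def nonneg_dens)
        then show "norm (t ^ k / fact k * w k x) \<le> real j ^ k / fact k * w' k x"
          using True by (simp add: w_def abs_mult power_abs) (simp add: w'_def nonneg_dens)
      qed
    next
      case False
      have "summable (\<lambda>k. t ^ k / fact k)"
        using summable_exp_generic[of t] by (simp add: field_simps scaleR_conv_of_real)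
      from summable_mult2[OF this, of "max 1 c"] False show ?thesis
        by (simp add: w_def)
    qed
    show "density \<pi> (\<lambda>x. ennreal (w k x)) = \<mu> k" for k
    proof -
      have "density \<pi> (\<lambda>x. ennreal (w k x)) = density \<pi> (\<lambda>x. ennreal (w' k x))"
        using good unfolding w_def by (intro density_cong) auto
      then show ?thesis by (simp add: dens_w')
    qed
  qed
qed

lemma kl_eq_entropy:
  assumes \<pi>: "prob_space \<pi>" and \<mu>: "prob_space \<mu>" "absolutely_continuous \<pi> \<mu>" "sets \<mu> = sets \<pi>"
    and fin: "kl \<mu> \<pi> < \<infinity>"
  shows "integrable \<pi> (\<lambda>x. \<Phi> (dens \<pi> \<mu> x))"
    and "real_of_ereal (kl \<mu> \<pi>) = (\<integral>x. \<Phi> (dens \<pi> \<mu> x) \<partial>\<pi>)"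
proof -
  have ent: "entropy_density (exp 1) \<pi> \<mu> = (\<lambda>x. ln (dens \<pi> \<mu> x))"
    by (simp add: entropy_density_def dens_def fun_eq_iff log_def)
  note d = density_dens[OF \<pi> \<mu>]
  have int: "integrable \<mu> (\<lambda>x. ln (dens \<pi> \<mu> x))"
    and kl: "real_of_ereal (kl \<mu> \<pi>) = (\<integral>x. ln (dens \<pi> \<mu> x) \<partial>\<mu>)"
    using fin by (auto simp: kl_def KL_divergence_def ent split: if_splits)
  have "integrable (density \<pi> (\<lambda>x. ennreal (dens \<pi> \<mu> x))) (\<lambda>x. ln (dens \<pi> \<mu> x))"
    using int by (simp only: d)
  then show "integrable \<pi> (\<lambda>x. \<Phi> (dens \<pi> \<mu> x))"
    by (subst (asm) integrable_density) (auto simp: nonneg_dens \<Phi>_def)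
  have "(\<integral>x. ln (dens \<pi> \<mu> x) \<partial>density \<pi> (\<lambda>x. ennreal (dens \<pi> \<mu> x))) = (\<integral>x. \<Phi> (dens \<pi> \<mu> x) \<partial>\<pi>)"
    by (subst integral_density) (auto simp: nonneg_dens \<Phi>_def)
  then show "real_of_ereal (kl \<mu> \<pi>) = (\<integral>x. \<Phi> (dens \<pi> \<mu> x) \<partial>\<pi>)"
    by (simp only: kl d)
qed

text \<open>Passes from the processes to the locales. The laws of the jump chain are absolutely
  continuous by induction with (H.1), which provides the \<open>w k\<close>; each quantity given
  through \<open>dens\<close> is then identified almost everywhere with its chosen version.\<close>

lemma posterior_entropy:
  fixes \<pi> \<mu>\<^sub>0 :: "'a::topological_space measure"
  assumes M: "prob_space M" and Q: "markov_kernel Q" and X: "markov_chain M X \<mu>\<^sub>0 Q"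
    and N: "poisson_process M 1 N" and indep: "indep_processes M X N"
    and P: "markov_kernel P" and \<pi>: "\<pi> \<in> space (prob_algebra borel)" and inv: "\<pi> \<bind> P = \<pi>"
    and ac: "absolutely_continuous \<pi> \<mu>\<^sub>0" and KL: "kl \<mu>\<^sub>0 \<pi> < \<infinity>"
    and c: "0 < c" "AE x in \<pi>. c \<le> dens \<pi> \<mu>\<^sub>0 x"
    and H1: "\<And>\<mu>. \<lbrakk>\<mu> \<in> space (prob_algebra borel); absolutely_continuous \<pi> \<mu>\<rbrakk>
      \<Longrightarrow> absolutely_continuous \<pi> (\<mu> \<bind> Q)"
    and H2: "\<And>t. 0 \<le> t \<Longrightarrow> integrable \<pi> (\<lambda>x. \<Phi> (dual_op \<pi> Q (dens \<pi> (distr M borel (poissonized X N t))) x))"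
    and LSI: "modified_LSI \<pi> P \<gamma>" and T: "0 < T"
  obtains u :: "'a \<Rightarrow> real" where "u \<in> borel_measurable borel" "\<And>x. 0 \<le> u x"
    "density \<pi> (\<lambda>x. ennreal (u x)) = distr M borel (poissonized X N T)"
    "integrable \<pi> u" "(\<integral>x. u x \<partial>\<pi>) = 1" "integrable \<pi> (\<lambda>x. \<Phi> (u x))"
    "(\<integral>x. \<Phi> (u x) \<partial>\<pi>)
      \<le> (LBINT t:{0..T}. exp (- \<gamma> * (T - t)) * kernel_diff \<pi> P Q (dens \<pi> (distr M borel (poissonized X N t))))
        + exp (- \<gamma> * T) * real_of_ereal (kl \<mu>\<^sub>0 \<pi>)"
proof -
  interpret M: prob_space M by fact
  have prob_\<pi>: "prob_space \<pi>" and sets_\<pi>[measurable_cong]: "sets \<pi> = sets borel"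
    using \<pi> by (simp_all add: space_prob_algebra)
  interpret \<pi>: prob_space \<pi> by fact
  have Xm[measurable]: "X k \<in> borel_measurable M" for k
    using X by (simp add: markov_chain_def)
  define \<mu> where "\<mu> k = distr M borel (X k)" for k
  define \<rho> where "\<rho> t = distr M borel (poissonized X N t)" for t
  have \<mu>_0: "\<mu> 0 = \<mu>\<^sub>0"
    using X by (simp add: markov_chain_def \<mu>_def)
  have \<mu>_Suc: "\<mu> (Suc k) = \<mu> k \<bind> Q" for k
    unfolding \<mu>_def by (rule markov_chain_law_Suc[OF M Q X])
  have \<mu>: "prob_space (\<mu> k)" "sets (\<mu> k) = sets borel" for k
    unfolding \<mu>_def by (auto intro: M.prob_space_distr)
  have \<mu>_ac: "absolutely_continuous \<pi> (\<mu> k)" for k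
  proof (induction k)
    case (Suc k)
    then show ?case
      unfolding \<mu>_Suc by (intro H1) (auto simp: space_prob_algebra \<mu>)
  qed (simp add: \<mu>_0 ac)
  obtain w where w[measurable]: "\<And>k. w k \<in> borel_measurable borel" and w_nonneg: "\<And>k x. 0 \<le> w k x"
    and w_c: "\<And>x. c \<le> w 0 x" and w_summable: "\<And>t x. summable (\<lambda>k. t ^ k / fact k * w k x)"
    and w_dens: "\<And>k. density \<pi> (\<lambda>x. ennreal (w k x)) = \<mu> k"
  proof (rule exists_summable_densities[OF prob_\<pi> sets_\<pi>, of \<mu> c])
    show "AE x in \<pi>. c \<le> dens \<pi> (\<mu> 0) x"
      using c by (simp add: \<mu>_0)
  qed (use \<mu> \<mu>_ac sets_\<pi> in auto)
  have nn_w: "(\<integral>\<^sup>+x. ennreal (w k x) \<partial>\<pi>) = 1" for k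
  proof -
    have "(\<integral>\<^sup>+x. ennreal (w k x) \<partial>\<pi>) = emeasure (\<mu> k) (space \<pi>)"
      by (subst w_dens[symmetric]) (simp add: emeasure_density)
    then show ?thesis
      using prob_space.emeasure_space_1[OF \<mu>(1)] sets_eq_imp_space_eq[OF \<mu>(2)] sets_eq_imp_space_eq[OF sets_\<pi>] by simp
  qed
  have dens_\<mu>\<^sub>0: "AE x in \<pi>. dens \<pi> \<mu>\<^sub>0 x = w 0 x"
    using w_dens[of 0] by (intro dens_density prob_\<pi>) (auto simp: w_nonneg \<mu>_0)
  have kl: "integrable \<pi> (\<lambda>x. \<Phi> (dens \<pi> \<mu>\<^sub>0 x))"
      "real_of_ereal (kl \<mu>\<^sub>0 \<pi>) = (\<integral>x. \<Phi> (dens \<pi> \<mu>\<^sub>0 x) \<partial>\<pi>)"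
    by (rule kl_eq_entropy[OF prob_\<pi> _ ac _ KL]; use \<mu>[of 0] in \<open>simp add: \<mu>_0 sets_\<pi>\<close>)+
  have AE_Phi: "AE x in \<pi>. \<Phi> (dens \<pi> \<mu>\<^sub>0 x) = \<Phi> (w 0 x)"
    using dens_\<mu>\<^sub>0 by eventually_elim simp
  have m0: "(\<lambda>x. \<Phi> (dens \<pi> \<mu>\<^sub>0 x)) \<in> borel_measurable \<pi>" "(\<lambda>x. \<Phi> (w 0 x)) \<in> borel_measurable \<pi>"
    by measurable
  have Phi_w: "integrable \<pi> (\<lambda>x. \<Phi> (w 0 x))"
    using kl(1) integrable_cong_AE[OF m0 AE_Phi] by simp
  have kl_w: "real_of_ereal (kl \<mu>\<^sub>0 \<pi>) = (\<integral>x. \<Phi> (w 0 x) \<partial>\<pi>)"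
    unfolding kl(2) by (rule integral_cong_AE[OF m0 AE_Phi])
  interpret jump_densities \<pi> w c
    by (intro jump_densities.intro jump_densities_axioms.intro prob_\<pi> sets_\<pi> w w_nonneg c(1) w_c
        w_summable nn_w)
  have u_law: "density \<pi> (\<lambda>x. ennreal (u t x)) = \<rho> t" if t: "0 \<le> t" for t
  proof (rule measure_eqI)
    fix A assume "A \<in> sets (density \<pi> (\<lambda>x. ennreal (u t x)))"
    then have A: "A \<in> sets borel"
      by (simp add: sets_\<pi>)
    show "emeasure (density \<pi> (\<lambda>x. ennreal (u t x))) A = emeasure (\<rho> t) A"
      unfolding emeasure_density_u[OF t A] \<rho>_def poissonized_law[OF M Xm N indep t A] w_dens \<mu>_def ..
  qed (simp add: sets_\<pi> \<rho>_def)
  have step: "density \<pi> (u t) \<bind> Q = density \<pi> (q t)" if "0 \<le> t" for t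
    using that markov_kernelD(2)[OF Q] by (rule bind_density_u) (simp add: w_dens \<mu>_Suc)
  have v_eq: "AE x in \<pi>. dens \<pi> (\<rho> t) x = u t x" if "0 \<le> t" for t
    using u_law[OF that] u_nonneg[OF that] by (intro dens_density prob_\<pi>) auto
  have dens_v: "density \<pi> (\<lambda>x. ennreal (dens \<pi> (\<rho> t) x)) = density \<pi> (u t)" if "0 \<le> t" for t
    using v_eq[OF that] by (intro density_cong) auto
  have q_eq: "AE x in \<pi>. dual_op \<pi> Q (dens \<pi> (\<rho> t)) x = q t x" if t: "0 \<le> t" for t
    unfolding dual_op_def dens_v[OF t] step[OF t]
    using q_nonneg[OF t] by (intro dens_density prob_\<pi>) auto
  \<comment> \<open>(H.2) at the horizon, from where the bound \<open>g\<close> carries it to all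
    earlier times.\<close>
  have Phi_q: "integrable \<pi> (\<lambda>x. \<Phi> (q T x))"
  proof -
    have "AE x in \<pi>. \<Phi> (dual_op \<pi> Q (dens \<pi> (\<rho> T)) x) = \<Phi> (q T x)"
      using q_eq[OF less_imp_le[OF T]] by eventually_elim simp
    moreover have "(\<lambda>x. \<Phi> (dual_op \<pi> Q (dens \<pi> (\<rho> T)) x)) \<in> borel_measurable \<pi>"
      unfolding dual_op_def by (rule measurable_compose[OF measurable_dens measurable_Phi])
    moreover have "(\<lambda>x. \<Phi> (q T x)) \<in> borel_measurable \<pi>"
      by measurable
    ultimately show ?thesis
      using H2[OF less_imp_le[OF T], folded \<rho>_def] by (subst (asm) integrable_cong_AE) auto
  qed
  interpret jump_densities_prior \<pi> w c T P
    by unfold_locales (fact T Phi_w Phi_q P inv)+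
  have kd: "kernel_diff \<pi> P Q (dens \<pi> (\<rho> t)) = J t - R t" if t: "t \<in> {0..T}" for t
  proof -
    have "kernel_diff \<pi> P Q (dens \<pi> (\<rho> t)) = kernel_diff \<pi> P Q (u t)"
    proof (rule kernel_diff_cong_AE[OF sets_\<pi> P Q])
      show v: "dens \<pi> (\<rho> t) \<in> borel_measurable borel"
        using measurable_dens[of \<pi> "\<rho> t"] by (simp add: sets_\<pi> cong: measurable_cong_sets)
      show "u t \<in> borel_measurable borel"
        by measurable
      show eq: "AE x in \<pi>. dens \<pi> (\<rho> t) x = u t x"
        using t by (intro v_eq) simp
      \<comment> \<open>The kernels keep null sets null: \<open>\<pi>\<close> is invariant under
        \<open>P\<close>, and for \<open>Q\<close> assumption (H.1) is applied to
        \<open>\<pi>\<close> itself.\<close>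
      then show "AE x in \<pi> \<bind> P. dens \<pi> (\<rho> t) x = u t x"
        unfolding inv .
      have "sets (\<pi> \<bind> Q) = sets \<pi>"
        unfolding sets_\<pi> by (rule sets_bind) (auto simp: markov_kernelD[OF Q] \<pi>.not_empty)
      moreover have "absolutely_continuous \<pi> (\<pi> \<bind> Q)"
        using \<pi> by (rule H1) (simp add: absolutely_continuous_def)
      ultimately show "AE x in \<pi> \<bind> Q. dens \<pi> (\<rho> t) x = u t x"
        using eq by (rule absolutely_continuous_AE)
    qed
    also have "\<dots> = J t - R t"
      using t by (intro kernel_diff_u[OF t Q] step) simp
    finally show ?thesis .
  qed
  show ?thesis
  proof (rule that[of "u T"])
    show "(\<integral>x. \<Phi> (u T x) \<partial>\<pi>)
      \<le> (LBINT t:{0..T}. exp (- \<gamma> * (T - t)) * kernel_diff \<pi> P Q (dens \<pi> (distr M borel (poissonized X N t))))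
        + exp (- \<gamma> * T) * real_of_ereal (kl \<mu>\<^sub>0 \<pi>)"
    proof -
      have "(LBINT t:{0..T}. exp (- \<gamma> * (T - t)) * kernel_diff \<pi> P Q (dens \<pi> (distr M borel (poissonized X N t))))
          = (LBINT t:{0..T}. exp (- \<gamma> * (T - t)) * (J t - R t))"
        by (intro set_lebesgue_integral_cong) (auto simp: kd[unfolded \<rho>_def])
      then show ?thesis
        using entropy_bound[OF LSI] by (simp add: kl_w H_def u_0)
    qed
    show "u T \<in> borel_measurable borel"
      by measurable
  qed (use T u_nonneg[of T] u_law[of T] integrable_u[of T] integral_u[of T] integrable_Phi_u[of T] in \<open>auto simp: \<rho>_def\<close>)
qed

section \<open>The generalization bound\<close>

theorem theorem12:
  fixes \<mu>\<^sub>z :: "'z measure" and n :: nat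
    and l :: "real ^ 'd \<Rightarrow> 'z \<Rightarrow> real" and \<Sigma> \<gamma> \<zeta> :: real
    and M :: "'w measure"
    and Q :: "(nat \<Rightarrow> 'z) \<Rightarrow> real ^ 'd \<Rightarrow> (real ^ 'd) measure"
    and \<mu>\<^sub>0 \<pi> :: "(real ^ 'd) measure"
    and X :: "(nat \<Rightarrow> 'z) \<Rightarrow> nat \<Rightarrow> 'w \<Rightarrow> real ^ 'd"
    and N :: "real \<Rightarrow> 'w \<Rightarrow> nat"
    and P :: "real ^ 'd \<Rightarrow> (real ^ 'd) measure"
  defines "\<D> \<equiv> (\<Pi>\<^sub>M i\<in>{..<n}. \<mu>\<^sub>z)"
  defines "\<rho> \<equiv> (\<lambda>S t. distr M borel (poissonized (X S) N t))"
  defines "v \<equiv> (\<lambda>S t. dens \<pi> (\<rho> S t))"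
  assumes data: "prob_space \<mu>\<^sub>z" "1 \<le> n"
    and loss: "(\<lambda>(w, z). l w z) \<in> borel_measurable (borel \<Otimes>\<^sub>M \<mu>\<^sub>z)"
      "\<And>w z. z \<in> space \<mu>\<^sub>z \<Longrightarrow> 0 \<le> l w z"
    and kernels: "\<And>S. S \<in> space \<D> \<Longrightarrow> markov_kernel (Q S)"
    and initial: "\<mu>\<^sub>0 \<in> space (prob_algebra borel)"
    and prob: "prob_space M"
    and chain: "\<And>S. S \<in> space \<D> \<Longrightarrow> markov_chain M (X S) \<mu>\<^sub>0 (Q S)"
    and poisson: "poisson_process M 1 N"
    and indep: "\<And>S. S \<in> space \<D> \<Longrightarrow> indep_processes M (X S) N"
    and prior: "markov_kernel P" "\<pi> \<in> space (prob_algebra borel)" "\<pi> \<bind> P = \<pi>"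
    and ac: "absolutely_continuous \<pi> \<mu>\<^sub>0"
    and compat_KL: "kl \<mu>\<^sub>0 \<pi> < \<infinity>"
    and compat_v0: "\<exists>c>0. AE x in \<pi>. c \<le> dens \<pi> \<mu>\<^sub>0 x"
    and compat_meas: "\<And>t. 0 \<le> t \<Longrightarrow> (\<lambda>S. kl (\<rho> S t) \<pi>) \<in> borel_measurable \<D>"
    and compat_H1: "\<And>S \<mu>. \<lbrakk>S \<in> space \<D>; \<mu> \<in> space (prob_algebra borel); absolutely_continuous \<pi> \<mu>\<rbrakk>
      \<Longrightarrow> absolutely_continuous \<pi> (\<mu> \<bind> Q S)"
    and compat_H2: "\<And>S t. \<lbrakk>S \<in> space \<D>; 0 \<le> t\<rbrakk>
      \<Longrightarrow> integrable \<pi> (\<lambda>x. \<Phi> (dual_op \<pi> (Q S) (v S t) x))"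
    and subgaussian: "0 \<le> \<Sigma>" "subgaussian_loss \<mu>\<^sub>z l (\<Sigma>\<^sup>2)"
    and LSI: "modified_LSI \<pi> P \<gamma>"
    and level: "0 < \<zeta>" "\<zeta> < 1"
  shows "\<exists>A \<in> sets \<D>. measure \<D> A \<ge> 1 - \<zeta> \<and>
    (\<forall>S\<in>A. \<forall>T>0.
       integrable M (\<lambda>\<omega>. gen_gap \<mu>\<^sub>z n l S (poissonized (X S) N T \<omega>)) \<and>
       (\<integral>\<omega>. gen_gap \<mu>\<^sub>z n l S (poissonized (X S) N T \<omega>) \<partial>M)
       \<le> 2 * \<Sigma> / sqrt (real n) *
          sqrt ((LBINT t:{0..T}. exp (- \<gamma> * (T - t)) * kernel_diff \<pi> P (Q S) (v S t))
                + exp (- \<gamma> * T) * real_of_ereal (kl \<mu>\<^sub>0 \<pi>)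
                + ln (3 / \<zeta>)))"
proof -
  interpret M: prob_space M by fact
  have prob_\<pi>: "prob_space \<pi>" and sets_\<pi>[measurable_cong]: "sets \<pi> = sets borel"
    using prior by (simp_all add: space_prob_algebra)
  obtain c where c: "0 < c" "AE x in \<pi>. c \<le> dens \<pi> \<mu>\<^sub>0 x"
    using compat_v0 by blast
  define Ebd where "Ebd S T = (LBINT t:{0..T}. exp (- \<gamma> * (T - t)) * kernel_diff \<pi> P (Q S) (v S t))
    + exp (- \<gamma> * T) * real_of_ereal (kl \<mu>\<^sub>0 \<pi>)" for S T
  let ?gap = "\<lambda>S T \<omega>. gen_gap \<mu>\<^sub>z n l S (poissonized (X S) N T \<omega>)"
  let ?goal = "\<lambda>S T. integrable M (?gap S T) \<and>
    (\<integral>\<omega>. ?gap S T \<omega> \<partial>M) \<le> 2 * \<Sigma> / sqrt (real n) * sqrt (Ebd S T + ln (3 / \<zeta>))"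
  \<comment> \<open>The expectation of the gap at the process is its integral under
    \<open>\<pi>\<close> weighted by the density \<open>u\<close>. The premise \<open>bd\<close>
    isolates what differs between positive \<open>\<Sigma>\<close> and
    \<open>\<Sigma> = 0\<close>.\<close>
  have transfer: "?goal S T"
    if S: "S \<in> space \<D>" and T: "0 < T"
      and bd: "\<And>u :: real ^ 'd \<Rightarrow> real. \<lbrakk>u \<in> borel_measurable borel; \<And>x. 0 \<le> u x; integrable \<pi> u; (\<integral>x. u x \<partial>\<pi>) = 1;
        integrable \<pi> (\<lambda>x. \<Phi> (u x)); (\<integral>x. \<Phi> (u x) \<partial>\<pi>) \<le> Ebd S T\<rbrakk>
        \<Longrightarrow> integrable \<pi> (\<lambda>x. u x * gen_gap \<mu>\<^sub>z n l S x) \<and>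
          (\<integral>x. u x * gen_gap \<mu>\<^sub>z n l S x \<partial>\<pi>) \<le> 2 * \<Sigma> / sqrt (real n) * sqrt (Ebd S T + ln (3 / \<zeta>))"
    for S T
  proof -
    obtain u where u[measurable]: "u \<in> borel_measurable borel" and u': "\<And>x. 0 \<le> u x"
      "density \<pi> (\<lambda>x. ennreal (u x)) = distr M borel (poissonized (X S) N T)"
      "integrable \<pi> u" "(\<integral>x. u x \<partial>\<pi>) = 1" "integrable \<pi> (\<lambda>x. \<Phi> (u x))" "(\<integral>x. \<Phi> (u x) \<partial>\<pi>) \<le> Ebd S T"
    proof (rule posterior_entropy[OF prob kernels[OF S] chain[OF S] poisson indep[OF S] prior ac
          compat_KL c _ _ LSI T])
      show "absolutely_continuous \<pi> (\<mu> \<bind> Q S)"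
        if "\<mu> \<in> space (prob_algebra borel)" "absolutely_continuous \<pi> \<mu>" for \<mu>
        by (rule compat_H1[OF S that])
      show "integrable \<pi> (\<lambda>x. \<Phi> (dual_op \<pi> (Q S) (dens \<pi> (distr M borel (poissonized (X S) N t))) x))"
        if "0 \<le> t" for t
        using compat_H2[OF S that] unfolding v_def \<rho>_def .
    qed (rule that; (assumption | (unfold Ebd_def v_def \<rho>_def, assumption)))
    note bound = bd[OF u u'(1,3-6)]
    have Y[measurable]: "poissonized (X S) N T \<in> borel_measurable M"
      using chain[OF S] poisson T
      by (intro measurable_poissonized) (auto simp: markov_chain_def poisson_process_def)
    have [measurable]: "gen_gap \<mu>\<^sub>z n l S \<in> borel_measurable borel"
      using measurable_Pair1[OF measurable_gen_gap[OF data(1) loss(1), of n, folded \<D>_def], of S] S by simp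
    have "integrable (density \<pi> (\<lambda>x. ennreal (u x))) (gen_gap \<mu>\<^sub>z n l S)"
      using bound u'(1) by (subst integrable_density) auto
    then have "integrable M (?gap S T)"
      unfolding u'(2) by (subst (asm) integrable_distr_eq) auto
    moreover have "(\<integral>\<omega>. ?gap S T \<omega> \<partial>M) = (\<integral>x. gen_gap \<mu>\<^sub>z n l S x \<partial>density \<pi> (\<lambda>x. ennreal (u x)))"
      unfolding u'(2) by (subst integral_distr) auto
    moreover have "\<dots> = (\<integral>x. u x * gen_gap \<mu>\<^sub>z n l S x \<partial>\<pi>)"
      using u'(1) by (subst integral_density) auto
    ultimately show ?thesis
      using bound by simp
  qed
  have gap_measurable: "gen_gap \<mu>\<^sub>z n l S \<in> borel_measurable \<pi>" if "S \<in> space \<D>" for S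
    using measurable_Pair1[OF measurable_gen_gap[OF data(1) loss(1), of n, folded \<D>_def], of S] that
    by (simp add: sets_\<pi> cong: measurable_cong_sets)
  have "\<exists>A \<in> sets \<D>. measure \<D> A \<ge> 1 - \<zeta> \<and> (\<forall>S\<in>A. \<forall>T>0. ?goal S T)"
  proof (cases "\<Sigma> = 0")
    case False
    with subgaussian(1) have \<Sigma>: "0 < \<Sigma>" by simp
    obtain A where A: "A \<in> sets \<D>" "1 - \<zeta> \<le> measure \<D> A"
      and exp_le: "\<And>S. S \<in> A \<Longrightarrow>
        (\<integral>\<^sup>+w. ennreal (exp (real n / (4 * \<Sigma>\<^sup>2) * (gen_gap \<mu>\<^sub>z n l S w)\<^sup>2)) \<partial>\<pi>) \<le> ennreal (3 / \<zeta>)"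
      using exp_moment_event[OF data loss(1) prob_\<pi> sets_\<pi> \<Sigma> subgaussian(2) level(1), folded \<D>_def] by blast
    have "?goal S T" if "S \<in> A" "0 < T" for S T
    proof (rule transfer)
      show S: "S \<in> space \<D>"
        using A(1) \<open>S \<in> A\<close> sets.sets_into_space by blast
      fix u :: "real ^ 'd \<Rightarrow> real"
      assume u: "u \<in> borel_measurable borel" "\<And>x. 0 \<le> u x" "integrable \<pi> u" "(\<integral>x. u x \<partial>\<pi>) = 1"
        "integrable \<pi> (\<lambda>x. \<Phi> (u x))" and le: "(\<integral>x. \<Phi> (u x) \<partial>\<pi>) \<le> Ebd S T"
      have "0 < real n / (4 * \<Sigma>\<^sup>2)" "0 < 3 / \<zeta>" "u \<in> borel_measurable \<pi>"
        using data(2) \<Sigma> level u(3) by auto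
      note sq = square_moment_bound[OF prob_\<pi> this(3) gap_measurable[OF S] u(2-5) this(1,2) exp_le[OF \<open>S \<in> A\<close>]]
      have "sqrt (((\<integral>x. \<Phi> (u x) \<partial>\<pi>) + ln (3 / \<zeta>)) / (real n / (4 * \<Sigma>\<^sup>2)))
          \<le> sqrt ((Ebd S T + ln (3 / \<zeta>)) / (real n / (4 * \<Sigma>\<^sup>2)))"
        using le by (intro real_sqrt_le_mono divide_right_mono) auto
      also have "\<dots> = 2 * \<Sigma> / sqrt (real n) * sqrt (Ebd S T + ln (3 / \<zeta>))"
        using \<Sigma> by (simp add: real_sqrt_divide real_sqrt_mult)
      finally show "integrable \<pi> (\<lambda>x. u x * gen_gap \<mu>\<^sub>z n l S x) \<and>
          (\<integral>x. u x * gen_gap \<mu>\<^sub>z n l S x \<partial>\<pi>) \<le> 2 * \<Sigma> / sqrt (real n) * sqrt (Ebd S T + ln (3 / \<zeta>))"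
        using sq by auto
    qed (rule \<open>0 < T\<close>)
    with A show ?thesis by blast
  next
    case True
    then have "subgaussian_loss \<mu>\<^sub>z l 0"
      using subgaussian(2) by simp
    then obtain A where A: "A \<in> sets \<D>" "measure \<D> A = 1"
      and null: "\<And>S. S \<in> A \<Longrightarrow> AE w in \<pi>. gen_gap \<mu>\<^sub>z n l S w = 0"
      using null_gap_event[OF data loss(1) prob_\<pi> sets_\<pi>, folded \<D>_def] by blast
    have "?goal S T" if "S \<in> A" "0 < T" for S T
    proof (rule transfer)
      show S: "S \<in> space \<D>"
        using A(1) \<open>S \<in> A\<close> sets.sets_into_space by blast
      fix u :: "real ^ 'd \<Rightarrow> real"
      assume u: "u \<in> borel_measurable borel"
      have [measurable]: "u \<in> borel_measurable \<pi>" "gen_gap \<mu>\<^sub>z n l S \<in> borel_measurable \<pi>"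
        using u gap_measurable[OF S] by (auto simp: sets_\<pi> cong: measurable_cong_sets)
      have eq: "AE x in \<pi>. u x * gen_gap \<mu>\<^sub>z n l S x = 0"
        using null[OF \<open>S \<in> A\<close>] by eventually_elim simp
      have "integrable \<pi> (\<lambda>x. u x * gen_gap \<mu>\<^sub>z n l S x)"
        by (subst integrable_cong_AE[OF _ _ eq]) auto
      moreover have "(\<integral>x. u x * gen_gap \<mu>\<^sub>z n l S x \<partial>\<pi>) = 0"
        using eq by (rule integral_eq_zero_AE)
      \<comment> \<open>The right-hand side is 0 through its factor \<open>\<Sigma>\<close>,
        whatever stands under the root.\<close>
      ultimately show "integrable \<pi> (\<lambda>x. u x * gen_gap \<mu>\<^sub>z n l S x) \<and>
          (\<integral>x. u x * gen_gap \<mu>\<^sub>z n l S x \<partial>\<pi>) \<le> 2 * \<Sigma> / sqrt (real n) * sqrt (Ebd S T + ln (3 / \<zeta>))"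
        using True by simp
    qed (rule \<open>0 < T\<close>)
    with A level show ?thesis by (intro bexI[of _ A]) auto
  qed
  then show ?thesis
    unfolding Ebd_def .
qed

end
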